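(* For each $n$ let $(\boldsymbol d^{l},\mathbf{Com})=(\boldsymbol d^{l,(n)},\mathbf{Com}^{(n)})$ be parameters of a random intersection graph with communities, and let $\mathrm{RIGC}_n=\mathrm{RIGC}(\boldsymbol d^{l},\mathbf{Com})$ be the random multigraph they define. Assume conditions (A)–(D) stated in the context. Let $V_n^{l}$ be uniform on the set of individuals $\mathscr V^{l}=[N_n]$, independently of the random matching $\omega_n$. Then, as $n\to\infty$, $(\mathrm{RIGC}_n,V_n^{l})$ converges in probability in the local weak sense to the random rooted graph $(\mathrm{CP},o)$ constructed in the context; i.e. for every fixed rooted graph $(G,o')$ and every $r\in\{0,1,2,\dots\}$, $$\frac1{N_n}\sum_{v\in[N_n]}\mathbf 1_{\{B_r(\mathrm{RIGC}_n,v)\simeq B_r(G,o')\}}\ \xrightarrow{\ \mathbb P\ }\ \mathbb P\big(B_r(\mathrm{CP},o)\simeq B_r(G,o')\big).$$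
   Context: **Model.** $\mathbb N=\{0,1,\dots\}$, $\mathbb Z^+=\{1,2,\dots\}$. For each $n$: individuals $\mathscr V^{l}=[N_n]$ and communities $\mathscr V^{r}=[M_n]$ (treated as disjoint sets), with $N_n,M_n\to\infty$. Each individual $v$ has a number of memberships ($l$-degree) $d^{l}_v\ge 1$. Let $\mathscr H$ be the set of non-empty, simple, finite, connected graphs, one representative per isomorphism class, with $H\in\mathscr H$ having vertex set $[|H|]$. Each community $a$ has a community graph $\mathrm{Com}_a\in\mathscr H$, and $r$-degree $d^{r}_a=|\mathrm{Com}_a|\ge1$. Assume $h_n:=\sum_{v}d^{l}_v=\sum_a d^{r}_a$. Individual $v$ has $l$-half-edges $(v,i)$, $i\in[d^l_v]$; community $a$ has $r$-half-edges $(a,k)$, $k\in[d^r_a]$, the half-edge $(a,k)$ representing the vertex of $\mathrm{Com}_a$ labelled $k$ (a "community role"). Let $\omega_n$ be a uniformly random bijection between $l$-half-edges and $r$-half-edges. If $(v,i)$ is matched to $(a,k)$ we say $v$ takes the role $j=(a,k)$. $\mathrm{RIGC}(\boldsymbol d^l,\mathbf{Com})$ is the random multigraph on $\mathscr V^l$ obtained by adding, for every community $a$ and every edge $\{j_1,j_2\}$ of $\mathrm{Com}_a$, one edge between the individuals taking roles $j_1$ and $j_2$ (self-loops and multiple edges allowed, each community edge copied separately). **Assumptions.** Let $D_n^l=d^l_{V}$ with $V$ uniform on $[N_n]$, $D_n^r=d^r_{A}$ with $A$ uniform on $[M_n]$, and $\mu^{(n)}_H=|\{a:\mathrm{Com}_a=H\}|/M_n$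 for $H\in\mathscr H$. (A) $D_n^l$ converges in distribution to a random variable $D^l$ with pmf $(p_k)_{k\in\mathbb Z^+}$. (B) $\mathbb E[D_n^l]\to\mathbb E[D^l]<\infty$. (C) There is a probability mass function $\mu$ on $\mathscr H$ with $\mu_H^{(n)}\to\mu_H$ for all $H$; consequently $D_n^r$ converges in distribution to $D^r$ with pmf $q_k=\sum_{|H|=k}\mu_H$. (D) $\mathbb E[D_n^r]\to\mathbb E[D^r]<\infty$. **Local convergence.** A rooted graph is a locally finite connected (multi)graph with a distinguished vertex; if a vertex of a disconnected graph is taken as root, one restricts to its connected component. $\simeq$ is graph isomorphism mapping root to root. $B_r(G,o)$ is the subgraph of $G$ spanned by the vertices at graph distance at most $r$ from $o$, rooted at $o$. **The limit $(\mathrm{CP},o)$.** For an $\mathbb N$-valued $X$ with finite positive mean let $\widetilde X$ have pmf $\mathbb P(\widetilde X=k)=(k+1)\mathbb P(X=k+1)/\mathbb E[X]$. Let $\mathrm{BP}_l$ be the ordered family tree of a branching process with independent offspring in which the root (generation $0$) has offspring distributed as $D^l$, each vertex in an odd generation has offspring distributed as $\widetilde D^r$, and each vertex in an even generation $\geq 2$ has offspring distributed as $\widetilde D^l$. Given $\mathrm{BP}_l$, write $d(u)$ for the degree of vertex $u$ in the tree. Independently, each odd-generation vertex $a$ receives a random graph $H\in\mathscr H$ with $|H|=d(a)$, chosen with probability $\mu_H/q_{d(a)}$. Independently for each vertex $u$, the $d(u)$ half-edges at $u$ receive distinct marks from $[d(u)]$: for $u$ not the root, the half-edge towards the parent gets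 a uniform mark $K\in[d(u)]$ and the half-edges towards the children get $[d(u)]\setminus\{K\}$ in increasing order; for the root, its half-edges get $1,\dots,d(\text{root})$ in order. $\mathrm{CP}$ is the graph whose vertices are the even-generation vertices of $\mathrm{BP}_l$; for every odd-generation vertex $a$ with graph $H$ and every edge $\{k,k'\}$ of $H$, one adds an edge between the two tree-neighbours of $a$ that are joined to $a$ through the half-edges at $a$ marked $k$ and $k'$. The root $o$ is the root of $\mathrm{BP}_l$. *)

theory Defs
  imports
    "HOL-Probability.Probability"
    "HOL-Library.Uprod"
    "HOL-Library.Extended_Nat"
begin

section \<open>Multigraphs and rooted graphs\<close>

text \<open>
  An undirected multigraph is given by its vertices and by the multiplicity of every
  unordered pair; \<open>Upair v v\<close> is a self-loop.  The record itself does not force edges to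
  run between vertices; this is \<open>wf_mgraph\<close>.
\<close>

record 'v mgraph =
  verts :: "'v set"
  mult :: "'v uprod \<Rightarrow> nat"

definition wf_mgraph :: "'v mgraph \<Rightarrow> bool" where
  "wf_mgraph G \<longleftrightarrow> (\<forall>e. mult G e > 0 \<longrightarrow> set_uprod e \<subseteq> verts G)"

definition adj :: "'v mgraph \<Rightarrow> ('v \<times> 'v) set" where
  "adj G = {(u, v). mult G (Upair u v) > 0}"

text \<open>The distance is \<open>\<infinity>\<close> between different connected components.\<close>

definition gdist :: "'v mgraph \<Rightarrow> 'v \<Rightarrow> 'v \<Rightarrow> enat" where
  "gdist G u v = (INF n\<in>{n. (u, v) \<in> adj G ^^ n}. enat n)"

definition connected_mgraph :: "'v mgraph \<Rightarrow> bool" where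
  "connected_mgraph G \<longleftrightarrow> (\<forall>u\<in>verts G. \<forall>v\<in>verts G. gdist G u v < \<infinity>)"

definition locally_finite :: "'v mgraph \<Rightarrow> bool" where
  "locally_finite G \<longleftrightarrow> (\<forall>v\<in>verts G. finite {e. v \<in> set_uprod e \<and> mult G e > 0})"

definition graph_iso :: "('v \<Rightarrow> 'w) \<Rightarrow> 'v mgraph \<Rightarrow> 'w mgraph \<Rightarrow> bool" where
  "graph_iso \<phi> G G' \<longleftrightarrow> bij_betw \<phi> (verts G) (verts G') \<and>
     (\<forall>e. set_uprod e \<subseteq> verts G \<longrightarrow> mult G' (map_uprod \<phi> e) = mult G e)"

definition isomorphic :: "'v mgraph \<Rightarrow> 'w mgraph \<Rightarrow> bool" where
  "isomorphic G G' \<longleftrightarrow> (\<exists>\<phi>. graph_iso \<phi> G G')"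

type_synonym 'v rooted = "'v mgraph \<times> 'v"

definition rooted_graph :: "'v rooted \<Rightarrow> bool" where
  "rooted_graph R \<longleftrightarrow> (case R of (G, x) \<Rightarrow>
     wf_mgraph G \<and> locally_finite G \<and> connected_mgraph G \<and> x \<in> verts G)"

definition rooted_iso :: "'v rooted \<Rightarrow> 'w rooted \<Rightarrow> bool" (infix \<open>\<simeq>\<^sub>r\<close> 50) where
  "R \<simeq>\<^sub>r R' \<longleftrightarrow> (\<exists>\<phi>. graph_iso \<phi> (fst R) (fst R') \<and> \<phi> (snd R) = snd R')"

definition induced :: "'v mgraph \<Rightarrow> 'v set \<Rightarrow> 'v mgraph" where
  "induced G W = \<lparr>verts = W, mult = (\<lambda>e. if set_uprod e \<subseteq> W then mult G e else 0)\<rparr>"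

text \<open>
  The neighbourhood \<open>B\<^sub>r(G, x)\<close>.  A disconnected \<open>G\<close> need not be restricted to the
  component of \<open>x\<close> first, since all other vertices are at distance \<open>\<infinity>\<close>.
\<close>

definition nbhd :: "nat \<Rightarrow> 'v mgraph \<Rightarrow> 'v \<Rightarrow> 'v rooted" where
  "nbhd r G x = (induced G {v \<in> verts G. gdist G x v \<le> enat r}, x)"


section \<open>Community graphs\<close>

text \<open>A finite simple graph on the vertex set \<open>{1..csize H}\<close>.\<close>

record cgraph =
  csize :: nat
  cedges :: "nat uprod set"

definition mgraph_of :: "cgraph \<Rightarrow> nat mgraph" where
  "mgraph_of H = \<lparr>verts = {1..csize H}, mult = (\<lambda>e. of_bool (e \<in> cedges H))\<rparr>"

definition community_graph :: "cgraph \<Rightarrow> bool" where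
  "community_graph H \<longleftrightarrow> csize H \<ge> 1 \<and>
     (\<forall>e\<in>cedges H. proper_uprod e \<and> set_uprod e \<subseteq> {1..csize H}) \<and>
     connected_mgraph (mgraph_of H)"

text \<open>A system containing exactly one representative of every isomorphism class.\<close>

definition community_reps :: "cgraph set \<Rightarrow> bool" where
  "community_reps \<H> \<longleftrightarrow> (\<forall>H\<in>\<H>. community_graph H) \<and>
     (\<forall>H. community_graph H \<longrightarrow> (\<exists>!H'. H' \<in> \<H> \<and> isomorphic (mgraph_of H) (mgraph_of H')))"


section \<open>The random intersection graph with communities\<close>

text \<open>
  There are \<open>N\<close> individuals and \<open>M\<close> communities, \<open>dl\<close> are the \<open>l\<close>-degrees, and
  \<open>Com a\<close> is the graph of community \<open>a\<close>.  The \<open>r\<close>-degree of \<open>a\<close> is \<open>csize (Com a)\<close>.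
\<close>

definition rigc_params ::
  "cgraph set \<Rightarrow> nat \<Rightarrow> nat \<Rightarrow> (nat \<Rightarrow> nat) \<Rightarrow> (nat \<Rightarrow> cgraph) \<Rightarrow> bool" where
  "rigc_params \<H> N M dl Com \<longleftrightarrow>
     (\<forall>v\<in>{1..N}. dl v \<ge> 1) \<and> (\<forall>a\<in>{1..M}. Com a \<in> \<H>) \<and>
     (\<Sum>v\<in>{1..N}. dl v) = (\<Sum>a\<in>{1..M}. csize (Com a))"

definition l_half_edges :: "nat \<Rightarrow> (nat \<Rightarrow> nat) \<Rightarrow> (nat \<times> nat) set" where
  "l_half_edges N dl = (SIGMA v:{1..N}. {1..dl v})"

definition r_half_edges :: "nat \<Rightarrow> (nat \<Rightarrow> cgraph) \<Rightarrow> (nat \<times> nat) set" where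
  "r_half_edges M Com = (SIGMA a:{1..M}. {1..csize (Com a)})"

text \<open>Extensionality makes the set of bijections finite without identifying any two of them.\<close>

definition matchings ::
  "nat \<Rightarrow> nat \<Rightarrow> (nat \<Rightarrow> nat) \<Rightarrow> (nat \<Rightarrow> cgraph) \<Rightarrow> (nat \<times> nat \<Rightarrow> nat \<times> nat) set" where
  "matchings N M dl Com =
     {\<omega> \<in> extensional (l_half_edges N dl). bij_betw \<omega> (l_half_edges N dl) (r_half_edges M Com)}"

definition matching_pmf ::
  "nat \<Rightarrow> nat \<Rightarrow> (nat \<Rightarrow> nat) \<Rightarrow> (nat \<Rightarrow> cgraph) \<Rightarrow> (nat \<times> nat \<Rightarrow> nat \<times> nat) pmf" where
  "matching_pmf N M dl Com = pmf_of_set (matchings N M dl Com)"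

definition role_taker ::
  "nat \<Rightarrow> (nat \<Rightarrow> nat) \<Rightarrow> (nat \<times> nat \<Rightarrow> nat \<times> nat) \<Rightarrow> nat \<times> nat \<Rightarrow> nat" where
  "role_taker N dl \<omega> j = fst (inv_into (l_half_edges N dl) \<omega> j)"

definition rigc ::
  "nat \<Rightarrow> nat \<Rightarrow> (nat \<Rightarrow> nat) \<Rightarrow> (nat \<Rightarrow> cgraph) \<Rightarrow> (nat \<times> nat \<Rightarrow> nat \<times> nat) \<Rightarrow> nat mgraph" where
  "rigc N M dl Com \<omega> =
     \<lparr>verts = {1..N},
      mult = (\<lambda>e. card {(a, f). a \<in> {1..M} \<and> f \<in> cedges (Com a) \<and>
                                map_uprod (\<lambda>k. role_taker N dl \<omega> (a, k)) f = e})\<rparr>"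


section \<open>Empirical distributions and modes of convergence\<close>

definition l_degree_pmf :: "nat \<Rightarrow> (nat \<Rightarrow> nat) \<Rightarrow> nat pmf" where
  "l_degree_pmf N dl = map_pmf dl (pmf_of_set {1..N})"

definition r_degree_pmf :: "nat \<Rightarrow> (nat \<Rightarrow> cgraph) \<Rightarrow> nat pmf" where
  "r_degree_pmf M Com = map_pmf (\<lambda>a. csize (Com a)) (pmf_of_set {1..M})"

definition converges_in_distribution :: "(nat \<Rightarrow> nat pmf) \<Rightarrow> nat pmf \<Rightarrow> bool" where
  "converges_in_distribution X Y \<longleftrightarrow>
     weak_conv_m (\<lambda>n. distr (measure_pmf (X n)) borel real) (distr (measure_pmf Y) borel real)"

text \<open>The \<open>n\<close>-th random variable lives on its own probability space.\<close>

definition converges_in_probability ::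
  "(nat \<Rightarrow> 'a measure) \<Rightarrow> (nat \<Rightarrow> 'a \<Rightarrow> real) \<Rightarrow> real \<Rightarrow> bool" where
  "converges_in_probability P X c \<longleftrightarrow>
     (\<forall>\<epsilon>>0. (\<lambda>n. \<P>(\<omega> in P n. \<bar>X n \<omega> - c\<bar> > \<epsilon>)) \<longlonglongrightarrow> 0)"


section \<open>The limit object\<close>

text \<open>The law of \<open>\<widetilde>X\<close>; meaningful if \<open>X\<close> has a finite positive mean.\<close>

definition size_biased :: "nat pmf \<Rightarrow> nat pmf" where
  "size_biased X =
     embed_pmf (\<lambda>k. real (k + 1) * pmf X (k + 1) / measure_pmf.expectation X real)"

text \<open>
  The branching tree is realised inside the set \<open>nat list\<close> of all finite words: the root
  is \<open>[]\<close> and the children of \<open>u\<close> are \<open>u @ [0]\<close>, \<open>u @ [1]\<close>, \dots, in this order, so that the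
  generation of \<open>u\<close> is its length.  Every word, in the tree or not, independently carries a
  label: its number of children, its community graph (odd generations only), and the
  mark of its half-edge towards the parent (0 at the root, which has no parent).
\<close>

datatype label = Label (nchildren: nat) (community: "cgraph option") (parent_mark: nat)

text \<open>
  Here \<open>p\<close> is the law of \<open>D\<^sup>l\<close>, and \<open>\<mu>\<close> the limiting law of the community graphs, so that
  \<open>map_pmf csize \<mu>\<close> is the law of \<open>D\<^sup>r\<close>.  A non-root vertex with \<open>k\<close> children has degree
  \<open>k + 1\<close>, and \<open>cond_pmf\<close> gives the graph \<open>H\<close> the probability \<open>\<mu>\<^sub>H / q\<^sub>k\<^sub>+\<^sub>1\<close>.
\<close>

definition label_pmf :: "nat pmf \<Rightarrow> cgraph pmf \<Rightarrow> nat list \<Rightarrow> label pmf" where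
  "label_pmf p \<mu> u =
     (if u = [] then map_pmf (\<lambda>k. Label k None 0) p
      else if even (length u) then
        do {
          k \<leftarrow> size_biased p;
          K \<leftarrow> pmf_of_set {1..k + 1};
          return_pmf (Label k None K)
        }
      else
        do {
          k \<leftarrow> size_biased (map_pmf csize \<mu>);
          H \<leftarrow> cond_pmf \<mu> {H. csize H = k + 1};
          K \<leftarrow> pmf_of_set {1..k + 1};
          return_pmf (Label k (Some H) K)
        })"

definition bp_space :: "nat pmf \<Rightarrow> cgraph pmf \<Rightarrow> (nat list \<Rightarrow> label) measure" where
  "bp_space p \<mu> = PiM UNIV (\<lambda>u. measure_pmf (label_pmf p \<mu> u))"

definition bp_tree :: "(nat list \<Rightarrow> label) \<Rightarrow> nat list set" where
  "bp_tree \<tau> = {u. \<forall>i<length u. u ! i < nchildren (\<tau> (take i u))}"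

definition tree_degree :: "(nat list \<Rightarrow> label) \<Rightarrow> nat list \<Rightarrow> nat" where
  "tree_degree \<tau> u = (if u = [] then nchildren (\<tau> u) else nchildren (\<tau> u) + 1)"

text \<open>
  The marks of the half-edges towards the children, in the order of the children.  At the
  root the parent mark is 0, and nothing is removed.
\<close>

definition child_marks :: "(nat list \<Rightarrow> label) \<Rightarrow> nat list \<Rightarrow> nat list" where
  "child_marks \<tau> u = sorted_list_of_set ({1..tree_degree \<tau> u} - {parent_mark (\<tau> u)})"

text \<open>\<open>joined \<tau> u k w\<close>: the half-edge at \<open>u\<close> marked \<open>k\<close> leads to the tree-neighbour \<open>w\<close>.\<close>

definition joined :: "(nat list \<Rightarrow> label) \<Rightarrow> nat list \<Rightarrow> nat \<Rightarrow> nat list \<Rightarrow> bool" where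
  "joined \<tau> u k w \<longleftrightarrow>
     (u \<noteq> [] \<and> w = butlast u \<and> k = parent_mark (\<tau> u)) \<or>
     (\<exists>i<nchildren (\<tau> u). w = u @ [i] \<and> k = child_marks \<tau> u ! i)"

definition CP :: "(nat list \<Rightarrow> label) \<Rightarrow> nat list mgraph" where
  "CP \<tau> =
     \<lparr>verts = {u \<in> bp_tree \<tau>. even (length u)},
      mult = (\<lambda>e. card {(a, f). a \<in> bp_tree \<tau> \<and> odd (length a) \<and>
                  f \<in> cedges (the (community (\<tau> a))) \<and>
                  (\<exists>k k' w w'. f = Upair k k' \<and> joined \<tau> a k w \<and> joined \<tau> a k' w' \<and>
                     e = Upair w w')})\<rparr>"

end

theory Submission
  imports Defs "HOL-Real_Asymp.Real_Asymp"
begin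

text \<open>
  The proof is the second moment method over finite labelled trees.  The neighbourhood of radius
  \<open>r\<close> in \<open>CP\<close> depends only on the labels of the first \<open>2 r + 1\<close> generations, that is, on one of
  countably many finite labelled trees \<open>t\<close>.  Call an individual \<open>v\<close> of type \<open>t\<close> if \<open>t\<close> can be placed
  injectively in the individuals and communities, with root at \<open>v\<close> and the prescribed degrees and
  community graphs, such that the matching pairs the half-edges as \<open>t\<close> prescribes.  The
  neighbourhood of \<open>v\<close> is then isomorphic to that of \<open>t\<close>, and \<open>v\<close> has at most one type.

  A tree with \<open>e\<close> edges can be placed in about \<open>\<Prod>\<^sub>u c\<^sub>u\<close> ways, where \<open>c\<^sub>u\<close> counts the individuals or
  communities with the label of \<open>u\<close>, and a placement is realised with probability \<open>(h - e)! / h!\<close>,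
  where \<open>h\<close> is the number of half-edges.  Hence the expected fraction of individuals of type \<open>t\<close>
  tends to \<open>\<Prod>\<^sub>u lim c\<^sub>u / h\<close> (with \<open>N\<close> for \<open>h\<close> at the root), which is exactly the probability of \<open>t\<close>
  in the branching tree.  Disjoint pairs of placements contribute the square of this limit to the
  second moment, and a placement meets boundedly many others, so the fraction of each type
  converges in probability.  Finitely many types carry almost all the mass of the limit.
\<close>


section \<open>Neighbourhoods and isomorphism\<close>

text \<open>The factor (h - e)! / h! behaves like h^(-e), which is one factor 1 / h for each of the
  e non-root vertices; this is why every vertex except the root is normalised by h. Cycles in the
  matching are never estimated. Placements are injective, so an individual whose exploration closes
  a cycle has no type, and such individuals turn out negligible because the limiting fractions of
  the types already sum to 1. The same total mass gives the upper bound: the types whose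
  neighbourhood differs from the target occupy their own share of the individuals. For each type it
  suffices to bound the mean from below and the second moment from above, so injectivity may cost
  boundedly many candidates per vertex and overlapping pairs may be bounded crudely. The radius 2 r
  + 1 is odd so that the last generation consists of communities: all half-edges of the individuals
  in the ball are then matched inside it, and only the outermost communities are partly
  explored.\<close>

lemma upair_in_adj_iff: "(u, v) \<in> adj G \<longleftrightarrow> mult G (Upair u v) > 0"
  by (simp add: adj_def)

lemma gdist_le_iff: "gdist G x y \<le> enat r \<longleftrightarrow> (\<exists>n\<le>r. (x, y) \<in> adj G ^^ n)"
proof
  assume le: "gdist G x y \<le> enat r"
  let ?S = "enat ` {n. (x, y) \<in> adj G ^^ n}"
  \<comment> \<open>An infimum of extended naturals is attained unless the set is empty, and then it
    is \<infinity>, which \<open>le\<close> excludes.\<close>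
  have "Inf ?S \<in> ?S"
  proof (cases "?S = {}")
    case True
    with le show ?thesis by (simp add: gdist_def Inf_enat_def)
  next
    case False
    then show ?thesis by (metis Inf_enat_def LeastI_ex ex_in_conv)
  qed
  with le show "\<exists>n\<le>r. (x, y) \<in> adj G ^^ n" by (auto simp: gdist_def)
next
  assume "\<exists>n\<le>r. (x, y) \<in> adj G ^^ n"
  then obtain n where "n \<le> r" "(x, y) \<in> adj G ^^ n" by blast
  then show "gdist G x y \<le> enat r"
    unfolding gdist_def by (intro INF_lower2[of n]) auto
qed

lemma set_map_uprod: "set_uprod (map_uprod f e) = f ` set_uprod e"
  by (cases e) auto

lemma map_uprod_comp: "map_uprod g (map_uprod f e) = map_uprod (g \<circ> f) e"
  by (cases e) auto

lemma map_uprod_inv: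
  assumes "\<And>x. x \<in> set_uprod e \<Longrightarrow> g (f x) = x"
  shows "map_uprod g (map_uprod f e) = e"
  using assms by (cases e) auto

lemma graph_iso_inverse:
  assumes "graph_iso \<phi> G G'"
  shows "graph_iso (inv_into (verts G) \<phi>) G' G"
proof -
  have bij: "bij_betw \<phi> (verts G) (verts G')" using assms by (simp add: graph_iso_def)
  let ?\<theta> = "inv_into (verts G) \<phi>"
  have bij': "bij_betw ?\<theta> (verts G') (verts G)" by (rule bij_betw_inv_into[OF bij])
  have "mult G (map_uprod ?\<theta> e) = mult G' e" if e: "set_uprod e \<subseteq> verts G'" for e
  proof -
    have "set_uprod (map_uprod ?\<theta> e) \<subseteq> verts G"
      using e bij' by (auto simp: set_map_uprod bij_betw_def)
    then have "mult G' (map_uprod \<phi> (map_uprod ?\<theta> e)) = mult G (map_uprod ?\<theta> e)"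
      using assms by (simp add: graph_iso_def)
    moreover have "map_uprod \<phi> (map_uprod ?\<theta> e) = e"
      using e bij by (intro map_uprod_inv) (auto simp: bij_betw_inv_into_right)
    ultimately show ?thesis by simp
  qed
  with bij' show ?thesis by (simp add: graph_iso_def)
qed

lemma graph_iso_compose:
  assumes "graph_iso \<phi> G G'" "graph_iso \<theta> G' G''"
  shows "graph_iso (\<theta> \<circ> \<phi>) G G''"
proof -
  have bij: "bij_betw \<phi> (verts G) (verts G')" "bij_betw \<theta> (verts G') (verts G'')"
    using assms by (simp_all add: graph_iso_def)
  have "set_uprod (map_uprod \<phi> e) \<subseteq> verts G'" if "set_uprod e \<subseteq> verts G" for e
    using that bij(1) by (auto simp: set_map_uprod bij_betw_def)
  with assms bij_betw_trans[OF bij] show ?thesis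
    by (simp add: graph_iso_def map_uprod_comp[symmetric])
qed

text \<open>The root has to be a vertex: off the vertex set an isomorphism is an arbitrary function,
  which \<open>inv_into\<close> does not undo.\<close>

lemma rooted_iso_sym:
  assumes "R \<simeq>\<^sub>r R'" and "snd R \<in> verts (fst R)"
  shows "R' \<simeq>\<^sub>r R"
proof -
  obtain \<phi> where \<phi>: "graph_iso \<phi> (fst R) (fst R')" "\<phi> (snd R) = snd R'"
    using assms(1) by (auto simp: rooted_iso_def)
  moreover have "inv_into (verts (fst R)) \<phi> (snd R') = snd R"
    using \<phi> assms(2) by (metis bij_betw_inv_into_left graph_iso_def)
  ultimately show ?thesis using graph_iso_inverse by (auto simp: rooted_iso_def)
qed

lemma rooted_iso_trans:
  assumes "R \<simeq>\<^sub>r R'" "R' \<simeq>\<^sub>r R''"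
  shows "R \<simeq>\<^sub>r R''"
  using assms graph_iso_compose unfolding rooted_iso_def by (metis comp_apply)

lemma rooted_iso_cong:
  assumes "R \<simeq>\<^sub>r R'" and "snd R \<in> verts (fst R)"
  shows "R \<simeq>\<^sub>r S \<longleftrightarrow> R' \<simeq>\<^sub>r S"
  using assms rooted_iso_sym rooted_iso_trans by metis

lemma root_in_nbhd: "x \<in> verts G \<Longrightarrow> snd (nbhd r G x) \<in> verts (fst (nbhd r G x))"
  by (auto simp: nbhd_def induced_def gdist_le_iff intro!: exI[of _ 0])

text \<open>No isomorphism of the whole graphs is available, so walks from the root are compared
  step by step. \<open>L n\<close> may be any superset of the ball of radius n, so distances in G
  need not be computed. \<open>fwd\<close> keeps the walks of G inside the layers,
  \<open>bwd\<close> lifts the walks of G' through \<psi>, and hence the two balls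
  correspond.\<close>

lemma nbhd_iso:
  assumes root: "x \<in> L 0"
    and mono: "\<And>n. n < r \<Longrightarrow> L n \<subseteq> L (Suc n)"
    and fwd: "\<And>n w w'. n < r \<Longrightarrow> w \<in> L n \<Longrightarrow> (w, w') \<in> adj G \<Longrightarrow> w' \<in> L (Suc n)"
    and bwd: "\<And>n w y. n < r \<Longrightarrow> w \<in> L n \<Longrightarrow> (\<psi> w, y) \<in> adj G' \<Longrightarrow> y \<in> \<psi> ` L (Suc n)"
    and verts: "L r \<subseteq> verts G" and verts': "\<psi> ` L r \<subseteq> verts G'"
    and inj: "inj_on \<psi> (L r)"
    and mult: "\<And>e. set_uprod e \<subseteq> L r \<Longrightarrow> mult G' (map_uprod \<psi> e) = mult G e"
  shows "nbhd r G x \<simeq>\<^sub>r nbhd r G' (\<psi> x)"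
proof -
  have Lr: "L n \<subseteq> L r" if "n \<le> r" for n
    using that by (induction rule: inc_induct) (use mono in blast)+
  have layer: "w \<in> L n" if "n \<le> r" "(x, w) \<in> adj G ^^ n" for n w
    using that
  proof (induction n arbitrary: w)
    case (Suc n)
    then show ?case using fwd by (metis Suc_le_eq less_imp_le relpow_Suc_E)
  qed (use root in auto)
  have adj: "(\<psi> w, \<psi> w') \<in> adj G' \<longleftrightarrow> (w, w') \<in> adj G" if "w \<in> L r" "w' \<in> L r" for w w'
    using mult[of "Upair w w'"] that by (simp add: upair_in_adj_iff)
  have walk: "(\<psi> x, y) \<in> adj G' ^^ n \<longleftrightarrow> (\<exists>w. y = \<psi> w \<and> (x, w) \<in> adj G ^^ n)" if "n \<le> r" for n y
    using that
  proof (induction n arbitrary: y)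
    case (Suc n)
    show ?case
    proof
      assume "(\<psi> x, y) \<in> adj G' ^^ Suc n"
      then obtain z where "(\<psi> x, z) \<in> adj G' ^^ n" and zy: "(z, y) \<in> adj G'"
        by (auto elim: relpow_Suc_E)
      then obtain w where w: "z = \<psi> w" "(x, w) \<in> adj G ^^ n" using Suc by auto
      have wL: "w \<in> L n" using layer w Suc by simp
      \<comment> \<open>\<open>bwd\<close> lifts the new endpoint; agreement of the multiplicities
        on \<open>L r\<close> then lifts the edge itself.\<close>
      then obtain w' where w': "y = \<psi> w'" "w' \<in> L (Suc n)"
        using bwd[of n w y] zy w Suc by auto
      have "(w, w') \<in> adj G"
        using adj[of w w'] wL w' Lr[of n] Lr[of "Suc n"] zy w Suc by auto
      then show "\<exists>w. y = \<psi> w \<and> (x, w) \<in> adj G ^^ Suc n"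
        using w w' by (auto intro: relpow_Suc_I)
    next
      assume "\<exists>w. y = \<psi> w \<and> (x, w) \<in> adj G ^^ Suc n"
      then obtain w' where w': "y = \<psi> w'" "(x, w') \<in> adj G ^^ Suc n" by blast
      then obtain w where w: "(x, w) \<in> adj G ^^ n" "(w, w') \<in> adj G" by (auto elim: relpow_Suc_E)
      have "w \<in> L r" "w' \<in> L r"
        using layer[OF _ w(1)] layer[OF _ w'(2)] Lr[of n] Lr[of "Suc n"] Suc by auto
      then have "(\<psi> w, \<psi> w') \<in> adj G'" using adj w by blast
      then show "(\<psi> x, y) \<in> adj G' ^^ Suc n"
        using Suc w w' by (metis Suc_leD relpow_Suc_I)
    qed
  qed auto
  let ?W = "{v \<in> verts G. gdist G x v \<le> enat r}"
  let ?W' = "{v \<in> verts G'. gdist G' (\<psi> x) v \<le> enat r}"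
  have WL: "?W \<subseteq> L r" using layer Lr by (fastforce simp: gdist_le_iff)
  have W': "?W' = \<psi> ` ?W"
  proof (intro equalityI subsetI)
    fix y assume "y \<in> ?W'"
    then obtain n where "n \<le> r" "(\<psi> x, y) \<in> adj G' ^^ n" by (auto simp: gdist_le_iff)
    moreover from this obtain w where "y = \<psi> w" "(x, w) \<in> adj G ^^ n" using walk by blast
    ultimately show "y \<in> \<psi> ` ?W" using layer Lr verts by (fastforce simp: gdist_le_iff)
  next
    fix y assume "y \<in> \<psi> ` ?W"
    then obtain w where w: "y = \<psi> w" "w \<in> ?W" by blast
    then obtain n where "n \<le> r" "(x, w) \<in> adj G ^^ n" by (auto simp: gdist_le_iff)
    moreover have "y \<in> verts G'" using w WL verts' by blast
    ultimately show "y \<in> ?W'" using walk w(1) by (auto simp: gdist_le_iff)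
  qed
  have "graph_iso \<psi> (induced G ?W) (induced G' ?W')"
    unfolding graph_iso_def
  proof (intro conjI allI impI)
    show "bij_betw \<psi> (verts (induced G ?W)) (verts (induced G' ?W'))"
      using W' inj WL by (auto simp: induced_def bij_betw_def intro: inj_on_subset)
    fix e assume "set_uprod e \<subseteq> verts (induced G ?W)"
    then have e: "set_uprod e \<subseteq> ?W" by (simp add: induced_def)
    then have "set_uprod (map_uprod \<psi> e) \<subseteq> ?W'" by (subst W') (auto simp: set_map_uprod)
    then show "mult (induced G' ?W') (map_uprod \<psi> e) = mult (induced G ?W) e"
      using e mult WL by (simp add: induced_def)
  qed
  then show ?thesis by (auto simp: nbhd_def rooted_iso_def)
qed


section \<open>Labelled trees\<close>

lemma bp_tree_Nil [simp]: "[] \<in> bp_tree \<tau>"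
  by (simp add: bp_tree_def)

lemma bp_tree_snoc [simp]: "u @ [i] \<in> bp_tree \<tau> \<longleftrightarrow> u \<in> bp_tree \<tau> \<and> i < nchildren (\<tau> u)"
  by (auto simp: bp_tree_def nth_append less_Suc_eq)

lemma bp_tree_butlast_last:
  "u \<in> bp_tree \<tau> \<Longrightarrow> u \<noteq> [] \<Longrightarrow> butlast u \<in> bp_tree \<tau> \<and> last u < nchildren (\<tau> (butlast u))"
  by (metis append_butlast_last_id bp_tree_snoc)

definition tree_ball :: "nat \<Rightarrow> (nat list \<Rightarrow> label) \<Rightarrow> nat list set" where
  "tree_ball R \<tau> = {u \<in> bp_tree \<tau>. length u \<le> R}"

lemma Nil_in_tree_ball [simp]: "[] \<in> tree_ball R \<tau>"
  by (simp add: tree_ball_def)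

lemma tree_ball_butlast: "u \<in> tree_ball R \<tau> \<Longrightarrow> butlast u \<in> tree_ball R \<tau>"
  by (cases "u = []") (auto simp: tree_ball_def bp_tree_butlast_last)

lemma finite_tree_ball: "finite (tree_ball R \<tau>)"
proof (induction R)
  case 0
  have "tree_ball 0 \<tau> \<subseteq> {[]}" by (auto simp: tree_ball_def)
  then show ?case by (rule finite_subset) simp
next
  case (Suc R)
  have "tree_ball (Suc R) \<tau> \<subseteq>
      {[]} \<union> (\<Union>u\<in>tree_ball R \<tau>. (\<lambda>i. u @ [i]) ` {..<nchildren (\<tau> u)})" (is "_ \<subseteq> ?A")
  proof
    fix u assume u: "u \<in> tree_ball (Suc R) \<tau>"
    show "u \<in> ?A"
    proof (cases u rule: rev_cases)
      case (snoc v i)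
      with u show ?thesis by (auto simp: tree_ball_def)
    qed simp
  qed
  then show ?case by (rule finite_subset) (use Suc in simp)
qed

text \<open>Membership of a word is decided by the labels of its proper prefixes. This is the reason
  for the extra generation \<open>Suc R\<close>.\<close>

lemma bp_tree_agree:
  assumes "\<And>u. u \<in> tree_ball R \<tau> \<Longrightarrow> \<tau>' u = \<tau> u" and "length u \<le> Suc R"
  shows "u \<in> bp_tree \<tau>' \<longleftrightarrow> u \<in> bp_tree \<tau>"
  using assms(2)
proof (induction u rule: rev_induct)
  case (snoc i u)
  then show ?case using assms(1)[of u] by (auto simp: tree_ball_def)
qed simp

lemma tree_ball_agree:
  assumes "\<And>u. u \<in> tree_ball R \<tau> \<Longrightarrow> \<tau>' u = \<tau> u"
  shows "tree_ball R \<tau>' = tree_ball R \<tau>"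
  using bp_tree_agree[OF assms] by (auto simp: tree_ball_def)


text \<open>
  A non-root vertex \<open>u\<close> stands for the tree edge towards its parent.  The edge consists of a
  half-edge at its even endpoint (\<open>b = True\<close>) and one at its odd endpoint (\<open>b = False\<close>).
\<close>

definition half_vertex :: "bool \<Rightarrow> nat list \<Rightarrow> nat list" where
  "half_vertex b u = (if odd (length u) = b then butlast u else u)"

definition half_mark :: "bool \<Rightarrow> (nat list \<Rightarrow> label) \<Rightarrow> nat list \<Rightarrow> nat" where
  "half_mark b \<tau> u =
     (if odd (length u) = b then child_marks \<tau> (butlast u) ! last u else parent_mark (\<tau> u))"

text \<open>The deterministic constraints obeyed by every label that \<open>label_pmf\<close>
  produces from community graphs. Since odd vertices are never the root,
  \<open>nchildren l + 1\<close> is their degree.\<close>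

definition proper_label :: "nat list \<Rightarrow> label \<Rightarrow> bool" where
  "proper_label u l \<longleftrightarrow>
     parent_mark l \<in> (if u = [] then {0} else {1..nchildren l + 1}) \<and>
     (if even (length u) then community l = None
      else \<exists>H. community l = Some H \<and> community_graph H \<and> csize H = nchildren l + 1)"

lemma set_child_marks: "set (child_marks \<tau> u) = {1..tree_degree \<tau> u} - {parent_mark (\<tau> u)}"
  by (simp add: child_marks_def)

lemma distinct_child_marks: "distinct (child_marks \<tau> u)"
  by (simp add: child_marks_def)

lemma length_child_marks: "proper_label u (\<tau> u) \<Longrightarrow> length (child_marks \<tau> u) = nchildren (\<tau> u)"
  by (cases "u = []") (auto simp: child_marks_def tree_degree_def proper_label_def card_Diff_singleton_if)

lemma child_marks_cong: "\<tau>' u = \<tau> u \<Longrightarrow> child_marks \<tau>' u = child_marks \<tau> u"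
  unfolding child_marks_def tree_degree_def by (simp only:)

lemma joined_cong: "\<tau>' a = \<tau> a \<Longrightarrow> joined \<tau>' a k w \<longleftrightarrow> joined \<tau> a k w"
  unfolding joined_def by (simp only: child_marks_cong[of \<tau>' a \<tau>])

lemma half_vertex_in_ball:
  assumes "u \<in> tree_ball R \<tau>" "u \<noteq> []"
  shows "half_vertex b u \<in> tree_ball R \<tau>" and "even (length (half_vertex b u)) = b"
  using assms tree_ball_butlast[OF assms(1)] by (auto simp: half_vertex_def)

lemma half_mark_range:
  assumes "u \<in> tree_ball R \<tau>" "u \<noteq> []" and proper: "\<And>u. u \<in> tree_ball R \<tau> \<Longrightarrow> proper_label u (\<tau> u)"
  shows "half_mark b \<tau> u \<in> {1..tree_degree \<tau> (half_vertex b u)}"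
proof (cases "odd (length u) = b")
  case True
  have "butlast u \<in> tree_ball R \<tau>" "last u < nchildren (\<tau> (butlast u))"
    using assms tree_ball_butlast bp_tree_butlast_last[of u \<tau>] by (auto simp: tree_ball_def)
  then have "child_marks \<tau> (butlast u) ! last u \<in> set (child_marks \<tau> (butlast u))"
    using proper by (simp add: length_child_marks)
  with True show ?thesis by (simp add: half_mark_def half_vertex_def set_child_marks)
next
  case False
  with proper[OF assms(1)] assms(2) show ?thesis
    by (auto simp: half_mark_def half_vertex_def proper_label_def tree_degree_def)
qed

text \<open>Different tree edges could collide at a vertex either as two child edges or as a child
  edge and the parent edge. The list \<open>child_marks\<close> is distinct and omits the parent
  mark, which excludes both.\<close>

lemma inj_half_edges:
  assumes proper: "\<And>u. u \<in> tree_ball R \<tau> \<Longrightarrow> proper_label u (\<tau> u)"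
  shows "inj_on (\<lambda>u. (half_vertex b u, half_mark b \<tau> u)) (tree_ball R \<tau> - {[]})"
proof (rule inj_onI, clarsimp)
  fix u u'
  assume u: "u \<in> tree_ball R \<tau>" "u \<noteq> []" and u': "u' \<in> tree_ball R \<tau>" "u' \<noteq> []"
    and v: "half_vertex b u = half_vertex b u'" and m: "half_mark b \<tau> u = half_mark b \<tau> u'"
  have child: "last w < length (child_marks \<tau> (butlast w))" if "w \<in> tree_ball R \<tau>" "w \<noteq> []" for w
    using that bp_tree_butlast_last[of w \<tau>] proper[OF tree_ball_butlast[OF that(1)]]
    by (auto simp: tree_ball_def length_child_marks)
  have fresh: "child_marks \<tau> (butlast w) ! last w \<noteq> parent_mark (\<tau> (butlast w))"
    if "w \<in> tree_ball R \<tau>" "w \<noteq> []" for w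
    using nth_mem[OF child[OF that]] by (auto simp: set_child_marks)
  consider "odd (length u) = b" "odd (length u') = b" | "odd (length u) = b" "odd (length u') \<noteq> b"
    | "odd (length u) \<noteq> b" "odd (length u') = b" | "odd (length u) \<noteq> b" "odd (length u') \<noteq> b"
    by blast
  then show "u = u'"
  proof cases
    case 1
    then have "butlast u = butlast u'" using v by (simp add: half_vertex_def)
    moreover from 1 this m have "last u = last u'"
      using child[OF u] child[OF u'] distinct_child_marks
      by (auto simp: half_mark_def nth_eq_iff_index_eq)
    ultimately show ?thesis using u u' by (metis append_butlast_last_id)
  next
    case 2
    then show ?thesis using v m fresh[OF u] by (auto simp: half_vertex_def half_mark_def)
  next
    case 3
    then show ?thesis using v m fresh[OF u'] by (auto simp: half_vertex_def half_mark_def)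
  next
    case 4
    then show ?thesis using v by (simp add: half_vertex_def)
  qed
qed

text \<open>The parent mark of w belongs to the edge indexed by w itself, every other mark to the
  edge indexed by a child. The child lies one generation deeper, hence the strict bound on the
  length of w. At the root the parent mark 0 is no admissible m.\<close>

lemma half_edge_exists:
  assumes w: "w \<in> tree_ball R \<tau>" "length w < R" "even (length w) = b"
    and proper: "proper_label w (\<tau> w)" and m: "m \<in> {1..tree_degree \<tau> w}"
  shows "\<exists>u\<in>tree_ball R \<tau> - {[]}. half_vertex b u = w \<and> half_mark b \<tau> u = m"
proof (cases "m = parent_mark (\<tau> w)")
  case True
  then have "w \<noteq> []" using m proper by (auto simp: proper_label_def)
  with True w show ?thesis by (intro bexI[of _ w]) (auto simp: half_vertex_def half_mark_def)
next
  case False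
  then have "m \<in> set (child_marks \<tau> w)" using m by (simp add: set_child_marks)
  then obtain i where i: "i < nchildren (\<tau> w)" "m = child_marks \<tau> w ! i"
    using proper by (auto simp: in_set_conv_nth length_child_marks)
  with w show ?thesis
    by (intro bexI[of _ "w @ [i]"]) (auto simp: half_vertex_def half_mark_def tree_ball_def)
qed

text \<open>Translates the language of \<open>CP\<close>, which names half-edges at communities,
  into the indexing by tree edges in which the matching conditions are stated.\<close>

lemma joined_iff_half_edge:
  assumes a: "a \<in> bp_tree \<tau>" "odd (length a)"
  shows "joined \<tau> a k w \<longleftrightarrow>
    (\<exists>u\<in>bp_tree \<tau> - {[]}. half_vertex False u = a \<and> half_mark False \<tau> u = k \<and> half_vertex True u = w)"
    (is "_ \<longleftrightarrow> ?R")
proof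
  assume "joined \<tau> a k w"
  then consider "w = butlast a" "k = parent_mark (\<tau> a)"
    | i where "i < nchildren (\<tau> a)" "w = a @ [i]" "k = child_marks \<tau> a ! i"
    by (auto simp: joined_def)
  then show ?R
  proof cases
    case 1
    with a show ?thesis by (intro bexI[of _ a]) (auto simp: half_vertex_def half_mark_def)
  next
    case 2
    with a show ?thesis by (intro bexI[of _ w]) (auto simp: half_vertex_def half_mark_def)
  qed
next
  assume ?R
  then obtain u where u: "u \<in> bp_tree \<tau>" "u \<noteq> []" "half_vertex False u = a"
    "half_mark False \<tau> u = k" "half_vertex True u = w" by blast
  show "joined \<tau> a k w"
  proof (cases "odd (length u)")
    case True
    with u show ?thesis by (simp add: joined_def half_vertex_def half_mark_def)
  next
    case False
    then have "a = butlast u" "w = u" "k = child_marks \<tau> a ! last u"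
      using u by (auto simp: half_vertex_def half_mark_def)
    with u show ?thesis
      using bp_tree_butlast_last[OF u(1,2)]
      unfolding joined_def by (intro disjI2 exI[of _ "last u"]) simp
  qed
qed

section \<open>Edges of \<open>CP\<close> and their dependence on finitely many labels\<close>

lemma joined_in_tree:
  assumes "a \<in> bp_tree \<tau>" "odd (length a)" "joined \<tau> a k w"
  shows "w \<in> bp_tree \<tau>" "even (length w)" "length w \<le> Suc (length a)" "length a \<le> Suc (length w)"
  using assms bp_tree_butlast_last[of a \<tau>] by (auto simp: joined_def)

lemma adj_CP_E:
  assumes "(w, w') \<in> adj (CP \<tau>)"
  obtains a k k' where "a \<in> bp_tree \<tau>" "odd (length a)"
    "Upair k k' \<in> cedges (the (community (\<tau> a)))" "joined \<tau> a k w" "joined \<tau> a k' w'"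
proof -
  let ?S = "{(a, f). a \<in> bp_tree \<tau> \<and> odd (length a) \<and> f \<in> cedges (the (community (\<tau> a))) \<and>
    (\<exists>k k' v v'. f = Upair k k' \<and> joined \<tau> a k v \<and> joined \<tau> a k' v' \<and> Upair w w' = Upair v v')}"
  have "card ?S > 0" using assms by (simp add: upair_in_adj_iff CP_def)
  then have "?S \<noteq> {}" by (metis card.empty less_irrefl)
  then obtain a k k' v v' where a: "a \<in> bp_tree \<tau>" "odd (length a)"
      "Upair k k' \<in> cedges (the (community (\<tau> a)))" "joined \<tau> a k v" "joined \<tau> a k' v'"
    and "Upair w w' = Upair v v'" by blast
  then consider "w = v" "w' = v'" | "w = v'" "w' = v" by auto
  then show ?thesis
  proof cases
    case 1
    with a show ?thesis by (intro that) auto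
  next
    case 2
    have "Upair k' k = Upair k k'" by simp
    with a(3) have "Upair k' k \<in> cedges (the (community (\<tau> a)))" by (simp only:)
    with a 2 show ?thesis by (intro that[of a k' k]) auto
  qed
qed

text \<open>An edge of \<open>CP\<close> passes through one community and therefore descends at most
  two generations. The layers contain the balls around the root and can be larger, since two members
  of a community need not be adjacent; they play the role of \<open>L\<close> in
  \<open>nbhd_iso\<close>.\<close>

definition layer :: "(nat list \<Rightarrow> label) \<Rightarrow> nat \<Rightarrow> nat list set" where
  "layer \<tau> n = {u \<in> bp_tree \<tau>. even (length u) \<and> length u \<le> 2 * n}"

lemma layer_mono: "n \<le> m \<Longrightarrow> layer \<tau> n \<subseteq> layer \<tau> m"
  by (auto simp: layer_def)

lemma adj_CP_layer:
  assumes "w \<in> layer \<tau> n" "(w, w') \<in> adj (CP \<tau>)"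
  shows "w' \<in> layer \<tau> (Suc n)"
  using assms(2)
proof (rule adj_CP_E)
  fix a k k'
  assume a: "a \<in> bp_tree \<tau>" "odd (length a)" "joined \<tau> a k w" "joined \<tau> a k' w'"
  show ?thesis
    using joined_in_tree[OF a(1,2,3)] joined_in_tree[OF a(1,2,4)] assms(1) by (auto simp: layer_def)
qed

text \<open>Distance \<open>r\<close> in \<open>CP\<close> is at most \<open>2 r\<close> in the tree, and the communities behind these vertices
  lie one generation deeper.\<close>

lemma nbhd_CP_local:
  assumes agree: "\<And>u. u \<in> tree_ball (2 * r + 1) \<tau> \<Longrightarrow> \<tau>' u = \<tau> u"
  shows "nbhd r (CP \<tau>) [] \<simeq>\<^sub>r nbhd r (CP \<tau>') []"
proof -
  have tree: "u \<in> bp_tree \<tau>' \<longleftrightarrow> u \<in> bp_tree \<tau>" if "length u \<le> 2 * r + 1" for u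
    using that by (intro bp_tree_agree[of "2 * r + 1"] agree) auto
  have lay: "layer \<tau>' n = layer \<tau> n" if "n \<le> r" for n
    using tree that by (auto simp: layer_def)
  have mult: "mult (CP \<tau>') e = mult (CP \<tau>) e" if e: "set_uprod e \<subseteq> layer \<tau> r" for e
  proof -
    have "a \<in> bp_tree \<tau>' \<and> odd (length a) \<and> f \<in> cedges (the (community (\<tau>' a))) \<and>
        (\<exists>k k' w w'. f = Upair k k' \<and> joined \<tau>' a k w \<and> joined \<tau>' a k' w' \<and> e = Upair w w') \<longleftrightarrow>
      a \<in> bp_tree \<tau> \<and> odd (length a) \<and> f \<in> cedges (the (community (\<tau> a))) \<and>
        (\<exists>k k' w w'. f = Upair k k' \<and> joined \<tau> a k w \<and> joined \<tau> a k' w' \<and> e = Upair w w')"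
      (is "?L \<longleftrightarrow> ?R") for a f
    proof (cases "length a \<le> 2 * r + 1 \<and> a \<in> bp_tree \<tau>")
      case True
      then have "\<tau>' a = \<tau> a" by (intro agree) (simp add: tree_ball_def)
      then show ?thesis using tree[of a] True by (simp add: joined_cong[of \<tau>' a \<tau>])
    next
      case False
      \<comment> \<open>A community producing an edge between vertices of depth at most 2 r is a
        tree-neighbour of such a vertex. So a community beyond the ball contributes nothing,
        whichever labelling is used.\<close>
      have short: "length a \<le> 2 * r + 1"
        if "a \<in> bp_tree \<tau>" "odd (length a)" "joined \<tau> a k w" "e = Upair w w'" for k w w'
        using joined_in_tree[OF that(1-3)] e that(4) by (auto simp: layer_def)
      have short': "length a \<le> 2 * r + 1"
        if "a \<in> bp_tree \<tau>'" "odd (length a)" "joined \<tau>' a k w" "e = Upair w w'" for k w w'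
        using joined_in_tree[OF that(1-3)] e that(4) by (auto simp: layer_def)
      have "\<not> ?R"
      proof
        assume R: ?R
        then have a: "a \<in> bp_tree \<tau>" "odd (length a)" by (auto simp only:)
        from R obtain k w w' where "joined \<tau> a k w" "e = Upair w w'" by (elim conjE exE)
        from short[OF a this] a(1) False show False by simp
      qed
      moreover have "\<not> ?L"
      proof
        assume L: ?L
        then have a: "a \<in> bp_tree \<tau>'" "odd (length a)" by (auto simp only:)
        from L obtain k w w' where "joined \<tau>' a k w" "e = Upair w w'" by (elim conjE exE)
        from short'[OF a this] a(1) False tree[of a] show False by simp
      qed
      ultimately show ?thesis by (simp only:)
    qed
    then show ?thesis by (simp add: CP_def)
  qed
  have "nbhd r (CP \<tau>) [] \<simeq>\<^sub>r nbhd r (CP \<tau>') (id [])"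
  proof (rule nbhd_iso[where L = "layer \<tau>"])
    fix n w y assume n: "n < r" and w: "w \<in> layer \<tau> n" and y: "(id w, y) \<in> adj (CP \<tau>')"
    have "w \<in> layer \<tau>' n" using w lay n by simp
    then have "y \<in> layer \<tau>' (Suc n)" using adj_CP_layer y by simp
    then show "y \<in> id ` layer \<tau> (Suc n)" using lay n by simp
  next
    fix e assume "set_uprod e \<subseteq> layer \<tau> r"
    moreover have "map_uprod id e = e" by (cases e) auto
    ultimately show "mult (CP \<tau>') (map_uprod id e) = mult (CP \<tau>) e" by (simp add: mult)
  next
    show "layer \<tau> r \<subseteq> verts (CP \<tau>)" "id ` layer \<tau> r \<subseteq> verts (CP \<tau>')"
      using lay[of r] by (auto simp: layer_def CP_def)
  qed (simp_all add: layer_def[of _ 0] adj_CP_layer layer_mono)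
  then show ?thesis by simp
qed


section \<open>Placements of a tree in the random graph\<close>

lemma map_uprod_eq_Upair_iff:
  "map_uprod g f = Upair x y \<longleftrightarrow> (\<exists>k k'. f = Upair k k' \<and> g k = x \<and> g k' = y)"
proof
  assume eq: "map_uprod g f = Upair x y"
  obtain k k' where f: "f = Upair k k'" by (cases f)
  moreover have "f = Upair k' k" using f by simp
  ultimately show "\<exists>k k'. f = Upair k k' \<and> g k = x \<and> g k' = y" using eq by fastforce
qed auto

text \<open>The two ends of a community edge can be listed in the order of w and w', which removes
  the equation between unordered pairs. The pairs \<open>(a, f)\<close> carry the unordered f, so no
  edge is counted twice.\<close>

lemma mult_CP_Upair:
  "mult (CP \<tau>) (Upair w w') =
     card {(a, f). a \<in> bp_tree \<tau> \<and> odd (length a) \<and> f \<in> cedges (the (community (\<tau> a))) \<and>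
             (\<exists>k k'. f = Upair k k' \<and> joined \<tau> a k w \<and> joined \<tau> a k' w')}"
proof -
  have "(\<exists>k k' v v'. f = Upair k k' \<and> J k v \<and> J k' v' \<and> Upair w w' = Upair v v') \<longleftrightarrow>
      (\<exists>k k'. f = Upair k k' \<and> J k w \<and> J k' w')" (is "?L \<longleftrightarrow> ?R") for f and J :: "nat \<Rightarrow> nat list \<Rightarrow> bool"
  proof
    assume ?L
    then obtain k k' v v' where f: "f = Upair k k'" and J: "J k v" "J k' v'"
      and "Upair w w' = Upair v v'" by blast
    moreover have "f = Upair k' k" using f by simp
    ultimately show ?R using Upair_inject by metis
  qed blast
  then show ?thesis by (simp add: CP_def)
qed

definition candidates ::
  "nat \<Rightarrow> nat \<Rightarrow> (nat \<Rightarrow> nat) \<Rightarrow> (nat \<Rightarrow> cgraph) \<Rightarrow> (nat list \<Rightarrow> label) \<Rightarrow> nat list \<Rightarrow> nat set" where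
  "candidates N M dl Com \<tau> u =
     (if even (length u) then {v \<in> {1..N}. dl v = tree_degree \<tau> u}
      else {a \<in> {1..M}. community (\<tau> u) = Some (Com a)})"

text \<open>
  Injectivity is required even between individuals and communities, although these are
  different objects carrying the same numbers; this costs nothing in the limit.
\<close>

definition placements ::
  "nat \<Rightarrow> nat \<Rightarrow> (nat \<Rightarrow> nat) \<Rightarrow> (nat \<Rightarrow> cgraph) \<Rightarrow> nat \<Rightarrow> (nat list \<Rightarrow> label) \<Rightarrow> (nat list \<Rightarrow> nat) set" where
  "placements N M dl Com R \<tau> =
     {\<psi> \<in> PiE (tree_ball R \<tau>) (candidates N M dl Com \<tau>). inj_on \<psi> (tree_ball R \<tau>)}"

definition half_edge :: "bool \<Rightarrow> (nat list \<Rightarrow> label) \<Rightarrow> (nat list \<Rightarrow> nat) \<Rightarrow> nat list \<Rightarrow> nat \<times> nat" where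
  "half_edge b \<tau> \<psi> u = (\<psi> (half_vertex b u), half_mark b \<tau> u)"

definition realises :: "nat \<Rightarrow> (nat list \<Rightarrow> label) \<Rightarrow> (nat \<times> nat \<Rightarrow> nat \<times> nat) \<Rightarrow> (nat list \<Rightarrow> nat) \<Rightarrow> bool" where
  "realises R \<tau> \<omega> \<psi> \<longleftrightarrow>
     (\<forall>u\<in>tree_ball R \<tau> - {[]}. \<omega> (half_edge True \<tau> \<psi> u) = half_edge False \<tau> \<psi> u)"

definition proper_tree :: "nat \<Rightarrow> (nat list \<Rightarrow> label) \<Rightarrow> bool" where
  "proper_tree R \<tau> \<longleftrightarrow> (\<forall>u\<in>tree_ball R \<tau>. proper_label u (\<tau> u))"

lemma proper_treeD: "proper_tree R \<tau> \<Longrightarrow> u \<in> tree_ball R \<tau> \<Longrightarrow> proper_label u (\<tau> u)"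
  by (simp add: proper_tree_def)

lemma realisesD:
  "realises R \<tau> \<omega> \<psi> \<Longrightarrow> u \<in> tree_ball R \<tau> \<Longrightarrow> u \<noteq> [] \<Longrightarrow>
     \<omega> (half_edge True \<tau> \<psi> u) = half_edge False \<tau> \<psi> u"
  by (simp add: realises_def)

lemma placement_even:
  assumes "\<psi> \<in> placements N M dl Com R \<tau>" "u \<in> tree_ball R \<tau>" "even (length u)"
  shows "\<psi> u \<in> {1..N}" "dl (\<psi> u) = tree_degree \<tau> u"
  using assms by (auto simp: placements_def candidates_def dest!: PiE_mem)

lemma placement_odd:
  assumes "\<psi> \<in> placements N M dl Com R \<tau>" "u \<in> tree_ball R \<tau>" "odd (length u)"
  shows "\<psi> u \<in> {1..M}" "community (\<tau> u) = Some (Com (\<psi> u))"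
  using assms by (auto simp: placements_def candidates_def dest!: PiE_mem)

lemma placement_csize:
  assumes "\<psi> \<in> placements N M dl Com R \<tau>" "proper_tree R \<tau>" "u \<in> tree_ball R \<tau>" "odd (length u)"
  shows "csize (Com (\<psi> u)) = tree_degree \<tau> u"
  using placement_odd[OF assms(1,3,4)] proper_treeD[OF assms(2,3)] assms(4)
  by (auto simp: proper_label_def tree_degree_def)

lemma placement_inj: "\<psi> \<in> placements N M dl Com R \<tau> \<Longrightarrow> inj_on \<psi> (tree_ball R \<tau>)"
  by (simp add: placements_def)

lemma half_edge_mem:
  assumes \<psi>: "\<psi> \<in> placements N M dl Com R \<tau>" and proper: "proper_tree R \<tau>"
    and u: "u \<in> tree_ball R \<tau>" "u \<noteq> []"
  shows "half_edge True \<tau> \<psi> u \<in> l_half_edges N dl" "half_edge False \<tau> \<psi> u \<in> r_half_edges M Com"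
  using half_vertex_in_ball[OF u, of True] half_vertex_in_ball[OF u, of False]
    half_mark_range[OF u proper_treeD[OF proper], of True]
    half_mark_range[OF u proper_treeD[OF proper], of False]
    placement_even[OF \<psi>] placement_csize[OF \<psi> proper] placement_odd[OF \<psi>]
  by (auto simp: half_edge_def l_half_edges_def r_half_edges_def)

text \<open>With \<open>half_edge_mem\<close> this turns \<open>realises\<close> into prescribed,
  pairwise distinct values of \<omega> at pairwise distinct arguments, so that its probability is an
  exact count.\<close>

lemma inj_half_edge:
  assumes \<psi>: "\<psi> \<in> placements N M dl Com R \<tau>" and proper: "proper_tree R \<tau>"
  shows "inj_on (half_edge b \<tau> \<psi>) (tree_ball R \<tau> - {[]})"
proof (rule inj_onI)
  fix u u'
  assume u: "u \<in> tree_ball R \<tau> - {[]}" "u' \<in> tree_ball R \<tau> - {[]}"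
    and eq: "half_edge b \<tau> \<psi> u = half_edge b \<tau> \<psi> u'"
  then have "half_vertex b u = half_vertex b u'"
    using half_vertex_in_ball[of u R \<tau> b] half_vertex_in_ball[of u' R \<tau> b] placement_inj[OF \<psi>]
    by (auto simp: half_edge_def dest: inj_onD)
  then show "u = u'"
    using inj_onD[OF inj_half_edges[OF proper_treeD[OF proper], where b = b], where x = u and y = u'] u eq
    by (auto simp: half_edge_def)
qed

lemma matching_bij: "\<omega> \<in> matchings N M dl Com \<Longrightarrow> bij_betw \<omega> (l_half_edges N dl) (r_half_edges M Com)"
  by (simp add: matchings_def)

lemma role_taker_eqI:
  assumes "\<omega> \<in> matchings N M dl Com" "h \<in> l_half_edges N dl"
  shows "role_taker N dl \<omega> (\<omega> h) = fst h"
  using bij_betw_inv_into_left[OF matching_bij[OF assms(1)] assms(2)] by (simp add: role_taker_def)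

lemma role_takerE:
  assumes "\<omega> \<in> matchings N M dl Com" "j \<in> r_half_edges M Com"
  obtains i where "(role_taker N dl \<omega> j, i) \<in> l_half_edges N dl" "\<omega> (role_taker N dl \<omega> j, i) = j"
proof -
  let ?h = "inv_into (l_half_edges N dl) \<omega> j"
  have "?h \<in> l_half_edges N dl" "\<omega> ?h = j"
    using matching_bij[OF assms(1)] assms(2)
    by (auto simp: bij_betw_inv_into_right bij_betw_def inv_into_into)
  then show ?thesis by (intro that[of "snd ?h"]) (auto simp: role_taker_def)
qed

section \<open>A realised placement carries the neighbourhood in \<open>CP\<close> to the one in the
  random graph\<close>

context
  fixes N M r :: nat and dl :: "nat \<Rightarrow> nat" and Com :: "nat \<Rightarrow> cgraph"
    and \<tau> :: "nat list \<Rightarrow> label" and \<omega> :: "nat \<times> nat \<Rightarrow> nat \<times> nat" and \<psi> :: "nat list \<Rightarrow> nat"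
  assumes proper: "proper_tree (2 * r + 1) \<tau>"
    and \<omega>: "\<omega> \<in> matchings N M dl Com"
    and \<psi>: "\<psi> \<in> placements N M dl Com (2 * r + 1) \<tau>"
    and realises: "realises (2 * r + 1) \<tau> \<omega> \<psi>"
begin

text \<open>The tree edge between a and w is one of the equations in \<open>realises\<close>, and
  inverting \<omega> there names the individual. That w lies in the ball is a genuine restriction,
  because the children of a community in the last generation do not.\<close>

lemma role_taker_joined:
  assumes a: "a \<in> tree_ball (2 * r + 1) \<tau>" "odd (length a)"
    and w: "w \<in> tree_ball (2 * r + 1) \<tau>" and j: "joined \<tau> a k w"
  shows "role_taker N dl \<omega> (\<psi> a, k) = \<psi> w" "(\<psi> a, k) \<in> r_half_edges M Com"
proof -
  obtain u where u: "u \<in> bp_tree \<tau>" "u \<noteq> []" "half_vertex False u = a" "half_mark False \<tau> u = k"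
    "half_vertex True u = w"
    using j a joined_iff_half_edge[of a \<tau>] by (auto simp: tree_ball_def)
  \<comment> \<open>The index u of a tree edge is its lower endpoint, hence a or w.\<close>
  have uT: "u \<in> tree_ball (2 * r + 1) \<tau>"
    using u(3,5) a(1) w by (auto simp: half_vertex_def split: if_splits)
  have "\<omega> (half_edge True \<tau> \<psi> u) = (\<psi> a, k)"
    using realisesD[OF realises uT u(2)] u by (simp add: half_edge_def)
  then show "role_taker N dl \<omega> (\<psi> a, k) = \<psi> w"
    using role_taker_eqI[OF \<omega> half_edge_mem(1)[OF \<psi> proper uT u(2)]] u by (simp add: half_edge_def)
  show "(\<psi> a, k) \<in> r_half_edges M Com"
    using half_edge_mem(2)[OF \<psi> proper uT u(2)] u by (simp add: half_edge_def)
qed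

text \<open>All half-edges of an individual in the tree are matched inside the tree, so every role it
  takes is accounted for by a community of the tree.\<close>

lemma role_taker_in_tree:
  assumes w: "w \<in> tree_ball (2 * r + 1) \<tau>" "even (length w)"
    and j: "(A, k) \<in> r_half_edges M Com" and eq: "role_taker N dl \<omega> (A, k) = \<psi> w"
  obtains a where "a \<in> tree_ball (2 * r + 1) \<tau>" "odd (length a)" "A = \<psi> a" "joined \<tau> a k w"
proof -
  obtain i where i: "(\<psi> w, i) \<in> l_half_edges N dl" "\<omega> (\<psi> w, i) = (A, k)"
    using role_takerE[OF \<omega> j] eq by metis
  then have "i \<in> {1..tree_degree \<tau> w}"
    using placement_even[OF \<psi> w] by (auto simp: l_half_edges_def)
  \<comment> \<open>The radius is odd and w has even depth, so w is not in the last generation and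
    all its half-edges belong to tree edges in the ball.\<close>
  moreover have "length w < 2 * r + 1" using w by (auto simp: tree_ball_def le_less)
  ultimately obtain u where u: "u \<in> tree_ball (2 * r + 1) \<tau>" "u \<noteq> []" "half_vertex True u = w"
    "half_mark True \<tau> u = i"
    using half_edge_exists[of w _ \<tau> True i] w proper_treeD[OF proper w(1)] by auto
  have "half_edge False \<tau> \<psi> u = (A, k)"
    using realisesD[OF realises u(1,2)] u i by (simp add: half_edge_def)
  moreover have hv: "half_vertex False u \<in> tree_ball (2 * r + 1) \<tau>" "odd (length (half_vertex False u))"
    using half_vertex_in_ball[OF u(1,2)] by auto
  moreover have "joined \<tau> (half_vertex False u) (half_mark False \<tau> u) w"
    using joined_iff_half_edge[of "half_vertex False u" \<tau>] hv u by (auto simp: tree_ball_def)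
  ultimately show ?thesis by (intro that[of "half_vertex False u"]) (auto simp: half_edge_def)
qed

lemma community_edge_half_edges:
  assumes "a \<in> tree_ball (2 * r + 1) \<tau>" "odd (length a)" "Upair k k' \<in> cedges (Com (\<psi> a))"
  shows "k \<in> {1..tree_degree \<tau> a}" "k' \<in> {1..tree_degree \<tau> a}"
proof -
  have "community_graph (Com (\<psi> a))"
    using proper_treeD[OF proper assms(1)] placement_odd[OF \<psi> assms(1,2)] assms(2)
    by (auto simp: proper_label_def)
  then show "k \<in> {1..tree_degree \<tau> a}" "k' \<in> {1..tree_degree \<tau> a}"
    using assms(3) placement_csize[OF \<psi> proper assms(1,2)]
    by (fastforce simp: community_graph_def)+
qed

text \<open>The map \<open>(a, f)\<close> to \<open>(\<psi> a, f)\<close> is a bijection between the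
  community edges on the two sides. For surjectivity, a community giving an edge between \<psi> w
  and \<psi> w' is found in the tree from either end, and injectivity of \<psi> shows that both ends
  find the same vertex.\<close>

lemma mult_rigc_placement:
  assumes w: "w \<in> layer \<tau> r" "w' \<in> layer \<tau> r"
    and Com: "\<And>a. a \<in> {1..M} \<Longrightarrow> community_graph (Com a)"
  shows "mult (rigc N M dl Com \<omega>) (Upair (\<psi> w) (\<psi> w')) = mult (CP \<tau>) (Upair w w')"
proof -
  let ?T = "tree_ball (2 * r + 1) \<tau>"
  have wT: "w \<in> ?T" "w' \<in> ?T" "even (length w)" "even (length w')" using w by (auto simp: layer_def tree_ball_def)
  let ?S = "{(a, f). a \<in> bp_tree \<tau> \<and> odd (length a) \<and> f \<in> cedges (the (community (\<tau> a))) \<and>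
             (\<exists>k k'. f = Upair k k' \<and> joined \<tau> a k w \<and> joined \<tau> a k' w')}"
  let ?S' = "{(A, f). A \<in> {1..M} \<and> f \<in> cedges (Com A) \<and>
              map_uprod (\<lambda>k. role_taker N dl \<omega> (A, k)) f = Upair (\<psi> w) (\<psi> w')}"
  have ball: "a \<in> ?T" if "(a, f) \<in> ?S" for a f
  proof -
    obtain k where a: "a \<in> bp_tree \<tau>" "odd (length a)" "joined \<tau> a k w" using \<open>(a, f) \<in> ?S\<close> by blast
    show ?thesis using a(1) joined_in_tree[OF a] w(1) by (auto simp: tree_ball_def layer_def)
  qed
  have "bij_betw (\<lambda>(a, f). (\<psi> a, f)) ?S ?S'"
  proof (rule bij_betwI')
    fix x y assume "x \<in> ?S" "y \<in> ?S"
    then show "((\<lambda>(a, f). (\<psi> a, f)) x = (\<lambda>(a, f). (\<psi> a, f)) y) = (x = y)"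
      using ball placement_inj[OF \<psi>] by (cases x; cases y) (auto dest!: inj_onD)
  next
    fix x assume x: "x \<in> ?S"
    obtain a f where af: "x = (a, f)" by (cases x)
    then obtain k k' where a: "odd (length a)" "f \<in> cedges (the (community (\<tau> a)))"
      and f: "f = Upair k k'" "joined \<tau> a k w" "joined \<tau> a k' w'" using x by blast
    have aT: "a \<in> ?T" using ball x af by blast
    have "map_uprod (\<lambda>k. role_taker N dl \<omega> (\<psi> a, k)) f = Upair (\<psi> w) (\<psi> w')"
      using role_taker_joined[OF aT a(1)] wT f by simp
    then show "(\<lambda>(a, f). (\<psi> a, f)) x \<in> ?S'"
      using af a placement_odd[OF \<psi> aT a(1)] by auto
  next
    fix y assume y: "y \<in> ?S'"
    obtain A f where Af: "y = (A, f)" by (cases y)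
    then obtain k k' where A: "A \<in> {1..M}" "f \<in> cedges (Com A)"
      and f: "f = Upair k k'" "role_taker N dl \<omega> (A, k) = \<psi> w" "role_taker N dl \<omega> (A, k') = \<psi> w'"
      using y by (auto simp: map_uprod_eq_Upair_iff)
    have "(A, k) \<in> r_half_edges M Com" "(A, k') \<in> r_half_edges M Com"
      using Com[OF A(1)] A f(1) by (fastforce simp: r_half_edges_def community_graph_def)+
    note j = this
    obtain a where a: "a \<in> ?T" "odd (length a)" "A = \<psi> a" "joined \<tau> a k w"
      by (rule role_taker_in_tree[OF wT(1,3) j(1) f(2)])
    obtain a' where a': "a' \<in> ?T" "odd (length a')" "A = \<psi> a'" "joined \<tau> a' k' w'"
      by (rule role_taker_in_tree[OF wT(2,4) j(2) f(3)])
    have "a' = a" using a a' placement_inj[OF \<psi>] by (auto dest: inj_onD)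
    then have "(a, f) \<in> ?S"
      using a a' A(2) f(1) placement_odd[OF \<psi> a(1,2)] by (auto simp: tree_ball_def)
    then show "\<exists>x\<in>?S. y = (\<lambda>(a, f). (\<psi> a, f)) x" using Af a(3) by (intro bexI[of _ "(a, f)"]) auto
  qed
  from bij_betw_same_card[OF this] show ?thesis by (simp add: mult_CP_Upair rigc_def)
qed

text \<open>The substantial condition of \<open>nbhd_iso\<close> is \<open>bwd\<close>: an
  individual adjacent to \<psi> w must not be reached through a community or a role that the tree
  leaves out.\<close>

lemma nbhd_rigc_placement:
  assumes Com: "\<And>a. a \<in> {1..M} \<Longrightarrow> community_graph (Com a)"
  shows "nbhd r (CP \<tau>) [] \<simeq>\<^sub>r nbhd r (rigc N M dl Com \<omega>) (\<psi> [])"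
proof (rule nbhd_iso[where L = "layer \<tau>"])
  let ?T = "tree_ball (2 * r + 1) \<tau>"
  have lT: "layer \<tau> r \<subseteq> ?T" by (auto simp: layer_def tree_ball_def)
  show "layer \<tau> r \<subseteq> verts (CP \<tau>)" by (auto simp: layer_def CP_def)
  show "\<psi> ` layer \<tau> r \<subseteq> verts (rigc N M dl Com \<omega>)"
    using lT placement_even(1)[OF \<psi>] by (auto simp: rigc_def layer_def)
  show "inj_on \<psi> (layer \<tau> r)" using placement_inj[OF \<psi>] lT by (rule inj_on_subset)
  show "mult (rigc N M dl Com \<omega>) (map_uprod \<psi> e) = mult (CP \<tau>) e" if "set_uprod e \<subseteq> layer \<tau> r" for e
    using that mult_rigc_placement[OF _ _ Com] by (cases e) auto
  fix n w y assume n: "n < r" and w: "w \<in> layer \<tau> n" and y: "(\<psi> w, y) \<in> adj (rigc N M dl Com \<omega>)"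
  have wT: "w \<in> ?T" "even (length w)" using w layer_mono[of n r \<tau>] n lT by (auto simp: layer_def)
  let ?S' = "{(A, f). A \<in> {1..M} \<and> f \<in> cedges (Com A) \<and>
              map_uprod (\<lambda>k. role_taker N dl \<omega> (A, k)) f = Upair (\<psi> w) y}"
  have "card ?S' > 0" using y by (simp add: upair_in_adj_iff rigc_def)
  then have "?S' \<noteq> {}" by (metis card.empty less_irrefl)
  then obtain A f where A: "A \<in> {1..M}" "f \<in> cedges (Com A)"
    "map_uprod (\<lambda>k. role_taker N dl \<omega> (A, k)) f = Upair (\<psi> w) y" by blast
  then obtain k k' where f: "f = Upair k k'" "role_taker N dl \<omega> (A, k) = \<psi> w"
    "role_taker N dl \<omega> (A, k') = y" by (auto simp: map_uprod_eq_Upair_iff)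
  have "(A, k) \<in> r_half_edges M Com"
    using Com[OF A(1)] A f(1) by (fastforce simp: r_half_edges_def community_graph_def)
  then obtain a where a: "a \<in> ?T" "odd (length a)" "A = \<psi> a" "joined \<tau> a k w"
    using role_taker_in_tree[OF wT _ f(2)] by blast
  \<comment> \<open>Because n < r, the community a is not in the last generation. Hence the
    half-edge at a marked k' also belongs to a tree edge in the ball, and its other end is the tree
    vertex placed at y.\<close>
  have la: "length a \<le> 2 * n + 1"
    using joined_in_tree(4)[OF _ a(2,4)] a(1) w by (auto simp: tree_ball_def layer_def)
  have "k' \<in> {1..tree_degree \<tau> a}" using community_edge_half_edges[OF a(1,2)] A(2) f(1) a(3) by blast
  moreover have "even (length a) = False" "length a < 2 * r + 1" using a(2) la n by auto
  ultimately obtain u where u: "u \<in> ?T - {[]}" "half_vertex False u = a" "half_mark False \<tau> u = k'"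
    using half_edge_exists[OF a(1) _ _ proper_treeD[OF proper a(1)]] by blast
  let ?w' = "half_vertex True u"
  have j: "joined \<tau> a k' ?w'"
    using joined_iff_half_edge[of a \<tau>] a(1,2) u by (auto simp: tree_ball_def)
  have w'T: "?w' \<in> ?T" using half_vertex_in_ball[of u] u by auto
  have "y = \<psi> ?w'" using role_taker_joined(1)[OF a(1,2) w'T j] f(3) a(3) by simp
  moreover have "?w' \<in> layer \<tau> (Suc n)"
    using joined_in_tree[OF _ a(2) j] a(1) la by (auto simp: layer_def tree_ball_def)
  ultimately show "y \<in> \<psi> ` layer \<tau> (Suc n)" by blast
qed (simp_all add: layer_def[of _ 0] adj_CP_layer layer_mono)

end

section \<open>Uniqueness of occurrences and of types\<close>

lemma realises_step:
  assumes "realises R \<tau> \<omega> \<psi>" "u @ [i] \<in> tree_ball R \<tau>"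
  shows "even (length u) \<Longrightarrow>
      \<omega> (\<psi> u, child_marks \<tau> u ! i) = (\<psi> (u @ [i]), parent_mark (\<tau> (u @ [i])))"
    and "odd (length u) \<Longrightarrow>
      \<omega> (\<psi> (u @ [i]), parent_mark (\<tau> (u @ [i]))) = (\<psi> u, child_marks \<tau> u ! i)"
  using realisesD[OF assms] by (auto simp: half_edge_def half_vertex_def half_mark_def)

lemma matching_inj:
  assumes "\<omega> \<in> matchings N M dl Com" "\<omega> h = \<omega> h'" "h \<in> l_half_edges N dl" "h' \<in> l_half_edges N dl"
  shows "h = h'"
  using matching_bij[OF assms(1)] assms(2-) by (auto simp: bij_betw_def dest: inj_onD)

lemma placement_lower_half_edge:
  assumes \<psi>: "\<psi> \<in> placements N M dl Com R \<tau>" and proper: "proper_tree R \<tau>"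
    and u: "u @ [i] \<in> tree_ball R \<tau>"
  shows "even (length u) \<Longrightarrow> (\<psi> u, child_marks \<tau> u ! i) \<in> l_half_edges N dl"
    and "odd (length u) \<Longrightarrow> (\<psi> (u @ [i]), parent_mark (\<tau> (u @ [i]))) \<in> l_half_edges N dl"
  using half_edge_mem(1)[OF \<psi> proper u] by (auto simp: half_edge_def half_vertex_def half_mark_def)

text \<open>Along a tree edge the marks are fixed by \<tau>, so the image of one endpoint determines
  the image of the other: by applying \<omega> from the individual to the community, by injectivity
  of \<omega> in the opposite direction. Agreement therefore spreads both down from the root and up
  to it.\<close>

lemma placements_agree_iff:
  assumes \<omega>: "\<omega> \<in> matchings N M dl Com" and proper: "proper_tree R \<tau>"
    and \<psi>: "\<psi> \<in> placements N M dl Com R \<tau>" "realises R \<tau> \<omega> \<psi>"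
    and \<psi>': "\<psi>' \<in> placements N M dl Com R \<tau>" "realises R \<tau> \<omega> \<psi>'"
    and "u \<in> tree_ball R \<tau>"
  shows "\<psi> u = \<psi>' u \<longleftrightarrow> \<psi> [] = \<psi>' []"
  using \<open>u \<in> tree_ball R \<tau>\<close>
proof (induction u rule: rev_induct)
  case (snoc i u)
  have u: "u \<in> tree_ball R \<tau>" using tree_ball_butlast[OF snoc.prems] by simp
  have "\<psi> (u @ [i]) = \<psi>' (u @ [i]) \<longleftrightarrow> \<psi> u = \<psi>' u"
    using realises_step[OF \<psi>(2) snoc.prems] realises_step[OF \<psi>'(2) snoc.prems]
      placement_lower_half_edge[OF \<psi>(1) proper snoc.prems]
      placement_lower_half_edge[OF \<psi>'(1) proper snoc.prems] matching_inj[OF \<omega>]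
    by (cases "even (length u)") (metis prod.inject)+
  with snoc.IH[OF u] show ?case by simp
qed simp

lemma placement_unique:
  assumes "\<omega> \<in> matchings N M dl Com" "proper_tree R \<tau>"
    and \<psi>: "\<psi> \<in> placements N M dl Com R \<tau>" "realises R \<tau> \<omega> \<psi>"
    and \<psi>': "\<psi>' \<in> placements N M dl Com R \<tau>" "realises R \<tau> \<omega> \<psi>'"
    and "u \<in> tree_ball R \<tau>" "\<psi> u = \<psi>' u"
  shows "\<psi> = \<psi>'"
proof (rule PiE_ext)
  show "\<psi> \<in> PiE (tree_ball R \<tau>) (candidates N M dl Com \<tau>)" "\<psi>' \<in> PiE (tree_ball R \<tau>) (candidates N M dl Com \<tau>)"
    using \<psi>(1) \<psi>'(1) by (simp_all add: placements_def)
qed (use placements_agree_iff[OF assms(1-6)] assms(7,8) in blast)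

text \<open>An individual carries no graph, and the graph of a community fixes its number of
  children. It remains to compare what the random graph shows: the degree or the graph, and the
  mark.\<close>

lemma proper_label_eqI:
  assumes "proper_label u l" "proper_label u l'" "parent_mark l = parent_mark l'"
    and "even (length u) \<Longrightarrow> nchildren l = nchildren l'"
    and "odd (length u) \<Longrightarrow> community l = community l'"
  shows "l = l'"
  using assms by (cases l; cases l') (auto simp: proper_label_def split: if_splits)

text \<open>Exploration from the root is deterministic: the label of u gives the half-edges towards
  its children, \<omega> gives the matched half-edges with their owners and marks, and the degree or
  graph of each owner completes the label. So an individual has at most one type.\<close>

lemma tree_determined_by_root:
  assumes \<omega>: "\<omega> \<in> matchings N M dl Com"
    and \<tau>: "proper_tree R \<tau>" "\<psi> \<in> placements N M dl Com R \<tau>" "realises R \<tau> \<omega> \<psi>"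
    and \<tau>': "proper_tree R \<tau>'" "\<psi>' \<in> placements N M dl Com R \<tau>'" "realises R \<tau>' \<omega> \<psi>'"
    and root: "\<psi> [] = \<psi>' []" and u: "u \<in> tree_ball R \<tau>"
  shows "u \<in> tree_ball R \<tau>' \<and> \<psi>' u = \<psi> u \<and> \<tau>' u = \<tau> u"
  using u
proof (induction u rule: rev_induct)
  case Nil
  have "\<tau>' [] = \<tau> []"
  proof (rule proper_label_eqI[of "[]"])
    show "proper_label [] (\<tau>' [])" "proper_label [] (\<tau> [])"
      using proper_treeD[OF \<tau>'(1) Nil_in_tree_ball] proper_treeD[OF \<tau>(1) Nil_in_tree_ball] .
    then show "parent_mark (\<tau>' []) = parent_mark (\<tau> [])" by (simp add: proper_label_def)
    show "nchildren (\<tau>' []) = nchildren (\<tau> [])"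
      using placement_even(2)[OF \<tau>(2), of "[]"] placement_even(2)[OF \<tau>'(2), of "[]"] root
      by (simp add: tree_degree_def)
  qed simp
  then show ?case using root by simp
next
  case (snoc i u)
  let ?v = "u @ [i]"
  have v: "?v \<in> tree_ball R \<tau>" by (rule snoc.prems)
  have u: "u \<in> tree_ball R \<tau>" using tree_ball_butlast[OF v] by simp
  have IH: "u \<in> tree_ball R \<tau>'" "\<psi>' u = \<psi> u" "\<tau>' u = \<tau> u" using snoc.IH[OF u] by auto
  have v': "?v \<in> tree_ball R \<tau>'" using v IH by (auto simp: tree_ball_def)
  have cm: "child_marks \<tau>' u = child_marks \<tau> u" by (rule child_marks_cong) (rule IH(3))
  have eq: "\<psi>' ?v = \<psi> ?v \<and> parent_mark (\<tau>' ?v) = parent_mark (\<tau> ?v)"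
  proof (cases "even (length u)")
    case True
    then show ?thesis
      using realises_step(1)[OF \<tau>(3) v True] realises_step(1)[OF \<tau>'(3) v' True] IH(2) cm by simp
  next
    case False
    have "(\<psi> ?v, parent_mark (\<tau> ?v)) = (\<psi>' ?v, parent_mark (\<tau>' ?v))"
    proof (rule matching_inj[OF \<omega>])
      show "\<omega> (\<psi> ?v, parent_mark (\<tau> ?v)) = \<omega> (\<psi>' ?v, parent_mark (\<tau>' ?v))"
        using realises_step(2)[OF \<tau>(3) v False] realises_step(2)[OF \<tau>'(3) v' False] IH(2) cm by simp
    qed (use placement_lower_half_edge(2)[OF \<tau>(2,1) v False]
          placement_lower_half_edge(2)[OF \<tau>'(2,1) v' False] in simp_all)
    then show ?thesis by simp
  qed
  have "\<tau>' ?v = \<tau> ?v"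
  proof (rule proper_label_eqI[of ?v])
    show "proper_label ?v (\<tau>' ?v)" "proper_label ?v (\<tau> ?v)"
      using proper_treeD[OF \<tau>'(1) v'] proper_treeD[OF \<tau>(1) v] .
    show "parent_mark (\<tau>' ?v) = parent_mark (\<tau> ?v)" using eq by simp
    show "nchildren (\<tau>' ?v) = nchildren (\<tau> ?v)" if "even (length ?v)"
      using placement_even(2)[OF \<tau>(2) v that] placement_even(2)[OF \<tau>'(2) v' that] eq
      by (simp add: tree_degree_def)
    show "community (\<tau>' ?v) = community (\<tau> ?v)" if "odd (length ?v)"
      using placement_odd(2)[OF \<tau>(2) v that] placement_odd(2)[OF \<tau>'(2) v' that] eq by simp
  qed
  with eq v' show ?case by simp
qed


section \<open>First and second moment of the number of placements\<close>

text \<open>Once a single bijection e extending g is fixed, every other one is p \<circ> e for a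
  unique permutation p of the values that g leaves free.\<close>

lemma card_bijections_extending:
  assumes fin: "finite A" "finite B" and card: "card A = card B"
    and D: "D \<subseteq> A" and g: "inj_on g D" "g ` D \<subseteq> B"
  shows "card {f \<in> extensional A. bij_betw f A B \<and> (\<forall>x\<in>D. f x = g x)} = fact (card A - card D)"
proof -
  have finD: "finite D" using D fin finite_subset by blast
  have "card (A - D) = card (B - g ` D)"
    using fin card D g finD by (simp add: card_Diff_subset card_image)
  then obtain e0 where e0: "bij_betw e0 (A - D) (B - g ` D)"
    using finite_same_card_bij[of "A - D" "B - g ` D"] fin by auto
  define e where "e = (\<lambda>x. if x \<in> D then g x else e0 x)"
  have "bij_betw e D (g ` D)" using g(1) by (auto simp: e_def bij_betw_def inj_on_def)
  moreover have "bij_betw e (A - D) (B - g ` D)"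
    using e0 by (subst bij_betw_cong[of _ _ e0]) (auto simp: e_def)
  ultimately have "bij_betw e (D \<union> (A - D)) (g ` D \<union> (B - g ` D))"
    by (rule bij_betw_combine) auto
  then have e: "bij_betw e A B" using D g(2) by (simp add: Un_absorb1)
  have eD: "e x = g x" if "x \<in> D" for x using that by (simp add: e_def)
  let ?P = "{p. p permutes (B - g ` D)}"
  let ?F = "{f \<in> extensional A. bij_betw f A B \<and> (\<forall>x\<in>D. f x = g x)}"
  have "bij_betw (\<lambda>p. restrict (p \<circ> e) A) ?P ?F"
  proof (rule bij_betwI')
    fix p q assume p: "p \<in> ?P" and q: "q \<in> ?P"
    show "(restrict (p \<circ> e) A = restrict (q \<circ> e) A) = (p = q)"
    proof
      assume eq: "restrict (p \<circ> e) A = restrict (q \<circ> e) A"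
      show "p = q"
      proof
        fix y
        show "p y = q y"
        proof (cases "y \<in> B")
          case True
          then obtain x where "x \<in> A" "y = e x" using e by (auto simp: bij_betw_def)
          with fun_cong[OF eq, of x] show ?thesis by simp
        next
          case False
          with p q show ?thesis by (simp add: permutes_not_in)
        qed
      qed
    qed simp
  next
    fix p assume p: "p \<in> ?P"
    then have "p permutes B" by (auto dest: permutes_subset[of p "B - g ` D" B])
    then have "bij_betw (restrict (p \<circ> e) A) A B"
      using bij_betw_trans[OF e permutes_imp_bij] by (subst bij_betw_cong[of _ _ "p \<circ> e"]) auto
    moreover have "p (g x) = g x" if "x \<in> D" for x using p that by (auto simp: permutes_not_in)
    ultimately show "restrict (p \<circ> e) A \<in> ?F" using D eD by auto
  next
    fix f assume f: "f \<in> ?F"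
    \<comment> \<open>This is f composed with the inverse of e, written as the identity off the free
      values so that it is a permutation of the whole type.\<close>
    define p where "p = (\<lambda>y. if y \<in> B - g ` D then f (inv_into A e y) else y)"
    have ie: "inv_into A e (e x) = x" if "x \<in> A" for x
      using e that by (simp add: bij_betw_inv_into_left)
    have pe: "p (e x) = f x" if "x \<in> A" for x
    proof (cases "e x \<in> g ` D")
      case True
      then obtain x' where x': "x' \<in> D" "e x = g x'" by blast
      then have "e x = e x'" "x' \<in> A" using eD D by auto
      then have "x = x'" using e that by (auto simp: bij_betw_def dest: inj_onD)
      with x' f show ?thesis by (simp add: p_def)
    next
      case False
      moreover have "e x \<in> B" using e that by (auto simp: bij_betw_def)
      ultimately show ?thesis using ie[OF that] by (simp add: p_def)
    qed
    have bij: "bij_betw p B B"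
    proof -
      have "bij_betw (f \<circ> inv_into A e) B B"
        using bij_betw_trans[OF bij_betw_inv_into[OF e], of f B] f by simp
      moreover have "(f \<circ> inv_into A e) y = p y" if y: "y \<in> B" for y
      proof -
        obtain x where "x \<in> A" "y = e x" using e y by (auto simp: bij_betw_def)
        then show ?thesis by (simp add: ie pe)
      qed
      ultimately show ?thesis by (subst bij_betw_cong[of B p "f \<circ> inv_into A e"]) auto
    qed
    have "p permutes B" by (rule bij_imp_permutes[OF bij]) (simp add: p_def)
    then have "p permutes (B - g ` D)" by (rule permutes_superset) (auto simp: p_def)
    moreover have "f = restrict (p \<circ> e) A" using f pe by (auto simp: restrict_def extensional_def)
    ultimately show "\<exists>p\<in>?P. f = restrict (p \<circ> e) A" by (intro bexI[of _ p]) simp_all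
  qed
  then have "card ?F = card ?P" by (rule bij_betw_same_card[symmetric])
  also have "\<dots> = fact (card B - card (g ` D))"
    using fin finD g(2) by (subst card_permutations[of _ "card (B - g ` D)"]) (auto simp: card_Diff_subset)
  finally show ?thesis using card g(1) by (simp add: card_image)
qed

text \<open>The values are chosen one after another, and at most m of them are already taken.
  Truncated subtraction makes a factor, and with it the bound, 0 when some candidate set has at most
  m elements.\<close>

lemma card_inj_PiE_ge:
  assumes "finite T" "card T \<le> m" and "\<And>u. u \<in> T \<Longrightarrow> finite (C u)"
  shows "(\<Prod>u\<in>T. card (C u) - m) \<le> card {f \<in> PiE T C. inj_on f T}"
  using assms
proof (induction T)
  case (insert x T)
  let ?S = "{f \<in> PiE T C. inj_on f T}"
  have finS: "finite ?S"
    by (rule finite_subset[of _ "PiE T C"])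
      (use insert.hyps insert.prems in \<open>auto simp: finite_PiE\<close>)
  have bij: "bij_betw (\<lambda>(f, y). f(x := y)) (SIGMA f:?S. C x - f ` T) {f \<in> PiE (insert x T) C. inj_on f (insert x T)}"
  proof (rule bij_betw_byWitness[where f' = "\<lambda>f. (f(x := undefined), f x)"])
    show "\<forall>a\<in>SIGMA f:?S. C x - f ` T. (\<lambda>f. (f(x := undefined), f x)) (case a of (f, y) \<Rightarrow> f(x := y)) = a"
    proof
      fix z assume "z \<in> (SIGMA f:?S. C x - f ` T)"
      then obtain f y where z: "z = (f, y)" and "f \<in> PiE T C" by auto
      then have "f x = undefined" using insert.hyps by (auto dest: PiE_arb)
      then show "(\<lambda>f. (f(x := undefined), f x)) (case z of (f, y) \<Rightarrow> f(x := y)) = z"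
        using z by (simp add: fun_upd_idem)
    qed
    show "(\<lambda>(f, y). f(x := y)) ` (SIGMA f:?S. C x - f ` T) \<subseteq> {f \<in> PiE (insert x T) C. inj_on f (insert x T)}"
    proof
      fix g assume "g \<in> (\<lambda>(f, y). f(x := y)) ` (SIGMA f:?S. C x - f ` T)"
      then obtain f y where g: "g = f(x := y)" and f: "f \<in> PiE T C" "inj_on f T" "y \<in> C x" "y \<notin> f ` T"
        by auto
      have "f(x := y) ` T = f ` T" using insert.hyps by auto
      moreover have "inj_on (f(x := y)) T" using f(2) insert.hyps by (auto simp: inj_on_def)
      moreover have "f(x := y) \<in> PiE (insert x T) C" using f by (intro PiE_fun_upd)
      ultimately show "g \<in> {f \<in> PiE (insert x T) C. inj_on f (insert x T)}"
        using f g insert.hyps by (simp add: inj_on_insert)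
    qed
    show "(\<lambda>f. (f(x := undefined), f x)) ` {f \<in> PiE (insert x T) C. inj_on f (insert x T)}
        \<subseteq> (SIGMA f:?S. C x - f ` T)"
    proof
      fix z assume "z \<in> (\<lambda>f. (f(x := undefined), f x)) ` {f \<in> PiE (insert x T) C. inj_on f (insert x T)}"
      then obtain f where z: "z = (f(x := undefined), f x)"
        and f: "f \<in> PiE (insert x T) C" "inj_on f (insert x T)" by auto
      have "f(x := undefined) ` T = f ` T" using insert.hyps by auto
      moreover have "inj_on (f(x := undefined)) T" using f(2) insert.hyps by (auto simp: inj_on_def)
      moreover have "f(x := undefined) \<in> PiE T C"
        using f(1) insert.hyps by (auto simp: PiE_def extensional_def Pi_def)
      ultimately show "z \<in> (SIGMA f:?S. C x - f ` T)"
        using f z insert.hyps by (auto simp: inj_on_insert)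
    qed
  qed simp
  have "(\<Prod>u\<in>insert x T. card (C u) - m) = (\<Prod>u\<in>T. card (C u) - m) * (card (C x) - m)"
    using insert.hyps by simp
  also have "\<dots> \<le> card ?S * (card (C x) - m)"
  proof (rule mult_right_mono)
    show "(\<Prod>u\<in>T. card (C u) - m) \<le> card ?S"
      by (rule insert.IH) (use insert.hyps insert.prems in auto)
  qed simp
  also have "\<dots> = (\<Sum>f\<in>?S. card (C x) - m)" by simp
  also have "\<dots> \<le> (\<Sum>f\<in>?S. card (C x - f ` T))"
  proof (rule sum_mono)
    fix f assume "f \<in> ?S"
    have "card (f ` T) \<le> m" using card_image_le[of T f] insert.hyps insert.prems(1) by simp
    then show "card (C x) - m \<le> card (C x - f ` T)"
      using diff_card_le_card_Diff[of "f ` T" "C x"] insert.hyps by simp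
  qed
  also have "\<dots> = card (SIGMA f:?S. C x - f ` T)"
    by (rule card_SigmaI[symmetric]) (use finS insert.prems in auto)
  also have "\<dots> = card {f \<in> PiE (insert x T) C. inj_on f (insert x T)}"
    using bij by (rule bij_betw_same_card)
  finally show ?case .
qed simp

definition occurrences ::
  "nat \<Rightarrow> nat \<Rightarrow> (nat \<Rightarrow> nat) \<Rightarrow> (nat \<Rightarrow> cgraph) \<Rightarrow> nat \<Rightarrow> (nat list \<Rightarrow> label) \<Rightarrow>
     (nat \<times> nat \<Rightarrow> nat \<times> nat) \<Rightarrow> (nat list \<Rightarrow> nat) set" where
  "occurrences N M dl Com R \<tau> \<omega> = {\<psi> \<in> placements N M dl Com R \<tau>. realises R \<tau> \<omega> \<psi>}"

section \<open>Moments of the number of occurrences for fixed parameters\<close>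

context
  fixes N M :: nat and dl :: "nat \<Rightarrow> nat" and Com :: "nat \<Rightarrow> cgraph"
  assumes balance: "(\<Sum>v\<in>{1..N}. dl v) = (\<Sum>a\<in>{1..M}. csize (Com a))"
begin

abbreviation (input) "half_edge_total \<equiv> \<Sum>v\<in>{1..N}. dl v"

lemma card_half_edges:
  "card (l_half_edges N dl) = half_edge_total" "card (r_half_edges M Com) = half_edge_total"
  using balance by (simp_all add: l_half_edges_def r_half_edges_def)

lemma finite_half_edges: "finite (l_half_edges N dl)" "finite (r_half_edges M Com)"
  by (simp_all add: l_half_edges_def r_half_edges_def)

text \<open>The free index set serves one placement, with the tree edges as indices, two disjoint
  placements, with tree edges tagged by a Boolean, and the count of all matchings, with no
  index.\<close>

lemma card_matchings_constrained:
  assumes I: "finite I" and x: "inj_on x I" "x ` I \<subseteq> l_half_edges N dl"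
    and y: "inj_on y I" "y ` I \<subseteq> r_half_edges M Com"
  shows "card {\<omega> \<in> matchings N M dl Com. \<forall>i\<in>I. \<omega> (x i) = y i} = fact (half_edge_total - card I)"
proof -
  let ?g = "y \<circ> inv_into I x"
  have "{\<omega> \<in> matchings N M dl Com. \<forall>i\<in>I. \<omega> (x i) = y i} =
      {\<omega> \<in> extensional (l_half_edges N dl). bij_betw \<omega> (l_half_edges N dl) (r_half_edges M Com) \<and>
         (\<forall>h\<in>x ` I. \<omega> h = ?g h)}"
    using x(1) by (auto simp: matchings_def)
  also have "card \<dots> = fact (card (l_half_edges N dl) - card (x ` I))"
  proof (rule card_bijections_extending)
    show "inj_on ?g (x ` I)" using x(1) y(1) by (intro comp_inj_on) (auto simp: inj_on_def)
    show "?g ` x ` I \<subseteq> r_half_edges M Com" using x(1) y(2) by auto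
  qed (use x card_half_edges finite_half_edges in auto)
  finally show ?thesis using x(1) by (simp add: card_half_edges card_image)
qed

lemma card_matchings: "card (matchings N M dl Com) = fact half_edge_total"
  using card_matchings_constrained[of "{}"] by simp

lemma finite_matchings: "finite (matchings N M dl Com)"
  and matchings_nonempty: "matchings N M dl Com \<noteq> {}"
  using card_matchings by (auto intro: card_ge_0_finite)

lemma set_matching_pmf: "set_pmf (matching_pmf N M dl Com) = matchings N M dl Com"
  by (simp add: matching_pmf_def finite_matchings matchings_nonempty)

lemma integrable_matching_pmf: "integrable (measure_pmf (matching_pmf N M dl Com)) (f :: _ \<Rightarrow> real)"
  by (intro integrable_measure_pmf_finite) (simp add: set_matching_pmf finite_matchings)

lemma prob_matching_constrained:
  assumes "finite I" "inj_on x I" "x ` I \<subseteq> l_half_edges N dl" "inj_on y I" "y ` I \<subseteq> r_half_edges M Com"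
  shows "measure_pmf.prob (matching_pmf N M dl Com) {\<omega>. \<forall>i\<in>I. \<omega> (x i) = y i} =
    fact (half_edge_total - card I) / fact half_edge_total"
proof -
  have "matchings N M dl Com \<inter> {\<omega>. \<forall>i\<in>I. \<omega> (x i) = y i} =
      {\<omega> \<in> matchings N M dl Com. \<forall>i\<in>I. \<omega> (x i) = y i}" by auto
  then show ?thesis
    using card_matchings_constrained[OF assms]
    by (simp add: matching_pmf_def measure_pmf_of_set[OF matchings_nonempty finite_matchings] card_matchings)
qed

context
  fixes R :: nat and \<tau> :: "nat list \<Rightarrow> label"
  assumes proper: "proper_tree R \<tau>"
begin

abbreviation (input) "tverts \<equiv> tree_ball R \<tau>"
abbreviation (input) "plcs \<equiv> placements N M dl Com R \<tau>"

lemma finite_candidates: "finite (candidates N M dl Com \<tau> u)"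
  by (simp add: candidates_def)

lemma finite_placements: "finite plcs"
  by (rule finite_subset[of _ "PiE tverts (candidates N M dl Com \<tau>)"])
    (auto simp: placements_def finite_candidates finite_tree_ball intro!: finite_PiE)

lemma half_edge_image:
  assumes "\<psi> \<in> plcs"
  shows "half_edge True \<tau> \<psi> ` (tverts - {[]}) \<subseteq> l_half_edges N dl"
    and "half_edge False \<tau> \<psi> ` (tverts - {[]}) \<subseteq> r_half_edges M Com"
  using half_edge_mem[OF assms proper] by blast+

lemma card_placements_ge: "(\<Prod>u\<in>tverts. card (candidates N M dl Com \<tau> u) - card tverts) \<le> card plcs"
  unfolding placements_def
  by (rule card_inj_PiE_ge) (auto simp: finite_candidates finite_tree_ball)

lemma card_placements_le: "card plcs \<le> (\<Prod>u\<in>tverts. card (candidates N M dl Com \<tau> u))"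
proof -
  have "card plcs \<le> card (PiE tverts (candidates N M dl Com \<tau>))"
    by (rule card_mono) (auto simp: placements_def finite_candidates finite_tree_ball intro!: finite_PiE)
  then show ?thesis by (simp add: card_PiE finite_tree_ball)
qed

lemma prob_realises:
  assumes "\<psi> \<in> plcs"
  shows "measure_pmf.prob (matching_pmf N M dl Com) {\<omega>. realises R \<tau> \<omega> \<psi>} =
    fact (half_edge_total - card (tverts - {[]})) / fact half_edge_total"
  unfolding realises_def
  by (rule prob_matching_constrained)
    (simp_all only: finite_Diff finite_tree_ball inj_half_edge[OF assms proper] half_edge_image[OF assms])

text \<open>Disjoint images involve different half-edges on both sides of the matching, so the two
  systems of equations merge into one consistent system of twice the size.\<close>

lemma prob_realises_disjoint:
  assumes \<psi>: "\<psi> \<in> plcs" and \<psi>': "\<psi>' \<in> plcs" and disj: "\<psi> ` tverts \<inter> \<psi>' ` tverts = {}"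
  shows "measure_pmf.prob (matching_pmf N M dl Com) {\<omega>. realises R \<tau> \<omega> \<psi> \<and> realises R \<tau> \<omega> \<psi>'} =
    fact (half_edge_total - 2 * card (tverts - {[]})) / fact half_edge_total"
proof -
  let ?h = "\<lambda>b (c, u). half_edge b \<tau> (if c then \<psi> else \<psi>') u"
  let ?I = "(UNIV :: bool set) \<times> (tverts - {[]})"
  have inj: "inj_on (?h b) ?I" for b
  proof (rule inj_onI)
    fix x y assume x: "x \<in> ?I" and y: "y \<in> ?I" and eq: "?h b x = ?h b y"
    obtain c u where x': "x = (c, u)" by (cases x)
    obtain c' u' where y': "y = (c', u')" by (cases y)
    have "half_vertex b u \<in> tverts" "half_vertex b u' \<in> tverts"
      using x y x' y' half_vertex_in_ball by auto
    then have "c = c'"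
      using eq disj x' y' by (auto simp: half_edge_def split: if_splits)
    then show "x = y"
      using inj_onD[OF inj_half_edge[OF \<psi> proper, of b], of u u']
        inj_onD[OF inj_half_edge[OF \<psi>' proper, of b], of u u'] eq x y x' y'
      by (auto split: if_splits)
  qed
  have "{\<omega>. realises R \<tau> \<omega> \<psi> \<and> realises R \<tau> \<omega> \<psi>'} = {\<omega>. \<forall>i\<in>?I. \<omega> (?h True i) = ?h False i}"
    by (auto simp: realises_def all_bool_eq)
  moreover have "measure_pmf.prob (matching_pmf N M dl Com) {\<omega>. \<forall>i\<in>?I. \<omega> (?h True i) = ?h False i} =
      fact (half_edge_total - card ?I) / fact half_edge_total"
  proof (rule prob_matching_constrained[OF _ inj _ inj])
    show "?h True ` ?I \<subseteq> l_half_edges N dl" "?h False ` ?I \<subseteq> r_half_edges M Com"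
      using half_edge_image[OF \<psi>] half_edge_image[OF \<psi>'] by (fastforce split: if_splits)+
  qed (simp add: finite_tree_ball)
  ultimately show ?thesis by (simp add: card_cartesian_product)
qed

abbreviation (input) "occs \<equiv> occurrences N M dl Com R \<tau>"

lemma finite_occurrences: "finite (occs \<omega>)"
  by (simp add: occurrences_def finite_placements)

text \<open>By this the number of occurrences is the number of individuals of the given
  type.\<close>

lemma inj_occurrence_root:
  assumes "\<omega> \<in> matchings N M dl Com"
  shows "inj_on (\<lambda>\<psi>. \<psi> []) (occs \<omega>)"
  using placement_unique[OF assms proper _ _ _ _ Nil_in_tree_ball]
  unfolding inj_on_def occurrences_def by blast

lemma card_occurrences_le: "\<omega> \<in> matchings N M dl Com \<Longrightarrow> card (occs \<omega>) \<le> N"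
  using card_inj_on_le[OF inj_occurrence_root, of \<omega> "{1..N}"]
    placement_even(1)[of _ N M dl Com R \<tau> "[]"]
  by (simp add: occurrences_def image_subset_iff)

lemma expectation_occurrences:
  "measure_pmf.expectation (matching_pmf N M dl Com) (\<lambda>\<omega>. real (card (occs \<omega>))) =
     card plcs * (fact (half_edge_total - card (tverts - {[]})) / fact half_edge_total)"
proof -
  have "real (card (occs \<omega>)) = (\<Sum>\<psi>\<in>plcs. indicator {\<omega>. realises R \<tau> \<omega> \<psi>} \<omega>)" for \<omega>
    using finite_placements by (simp add: occurrences_def indicator_def sum.If_cases Int_def)
  then have "measure_pmf.expectation (matching_pmf N M dl Com) (\<lambda>\<omega>. real (card (occs \<omega>))) =
      (\<Sum>\<psi>\<in>plcs. measure_pmf.prob (matching_pmf N M dl Com) {\<omega>. realises R \<tau> \<omega> \<psi>})"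
    by (simp add: Bochner_Integration.integral_sum integrable_matching_pmf)
  then show ?thesis by (simp add: prob_realises)
qed

text \<open>An occurrence meeting a given vertex at a given tree position is unique, so there are few
  overlapping pairs.\<close>

lemma card_overlapping_le:
  assumes \<omega>: "\<omega> \<in> matchings N M dl Com"
  shows "card {\<psi>' \<in> occs \<omega>. \<psi> ` tverts \<inter> \<psi>' ` tverts \<noteq> {}} \<le> (card tverts)\<^sup>2"
proof -
  have "{\<psi>' \<in> occs \<omega>. \<psi> ` tverts \<inter> \<psi>' ` tverts \<noteq> {}} \<subseteq>
      (\<Union>(u, u')\<in>tverts \<times> tverts. {\<psi>' \<in> occs \<omega>. \<psi> u = \<psi>' u'})" by auto
  then have "card {\<psi>' \<in> occs \<omega>. \<psi> ` tverts \<inter> \<psi>' ` tverts \<noteq> {}} \<le>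
      card (\<Union>(u, u')\<in>tverts \<times> tverts. {\<psi>' \<in> occs \<omega>. \<psi> u = \<psi>' u'})"
    by (rule card_mono[rotated]) (auto simp: finite_tree_ball finite_occurrences)
  also have "\<dots> \<le> (\<Sum>(u, u')\<in>tverts \<times> tverts. card {\<psi>' \<in> occs \<omega>. \<psi> u = \<psi>' u'})"
    using card_UN_le[of "tverts \<times> tverts" "\<lambda>(u, u'). {\<psi>' \<in> occs \<omega>. \<psi> u = \<psi>' u'}"]
    by (simp add: finite_tree_ball split_def)
  also have "\<dots> \<le> (\<Sum>(u, u')\<in>tverts \<times> tverts. 1)"
  proof (rule sum_mono, clarify)
    fix u u' assume "u' \<in> tverts"
    have "finite {\<psi>' \<in> occs \<omega>. \<psi> u = \<psi>' u'}" by (simp add: finite_occurrences)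
    moreover have "\<forall>\<psi>1\<in>{\<psi>' \<in> occs \<omega>. \<psi> u = \<psi>' u'}. \<forall>\<psi>2\<in>{\<psi>' \<in> occs \<omega>. \<psi> u = \<psi>' u'}. \<psi>1 = \<psi>2"
    proof (intro ballI)
      fix \<psi>1 \<psi>2
      assume "\<psi>1 \<in> {\<psi>' \<in> occs \<omega>. \<psi> u = \<psi>' u'}" "\<psi>2 \<in> {\<psi>' \<in> occs \<omega>. \<psi> u = \<psi>' u'}"
      then show "\<psi>1 = \<psi>2"
        using placement_unique[OF \<omega> proper, of \<psi>1 \<psi>2 u'] \<open>u' \<in> tverts\<close> by (simp add: occurrences_def)
    qed
    ultimately show "card {\<psi>' \<in> occs \<omega>. \<psi> u = \<psi>' u'} \<le> 1"
      unfolding One_nat_def by (rule card_le_Suc0_iff_eq[THEN iffD2])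
  qed
  also have "\<dots> = (card tverts)\<^sup>2" by (simp add: split_def card_cartesian_product power2_eq_square)
  finally show ?thesis .
qed

text \<open>Ordered pairs of occurrences are split into disjoint pairs, whose probabilities are all
  equal, and overlapping ones. The latter, including each occurrence paired with itself, are bounded
  for every matching rather than in expectation; they number O(N), which vanishes after division by
  the square of N.\<close>

lemma second_moment_occurrences:
  "measure_pmf.expectation (matching_pmf N M dl Com) (\<lambda>\<omega>. (real (card (occs \<omega>)))\<^sup>2) \<le>
     (real (card plcs))\<^sup>2 * (fact (half_edge_total - 2 * card (tverts - {[]})) / fact half_edge_total)
       + (real (card tverts))\<^sup>2 * N"
proof -
  let ?E = "measure_pmf.expectation (matching_pmf N M dl Com)"
  let ?D = "{(\<psi>, \<psi>') \<in> plcs \<times> plcs. \<psi> ` tverts \<inter> \<psi>' ` tverts = {}}"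
  let ?A = "\<lambda>(\<psi>, \<psi>'). {\<omega>. realises R \<tau> \<omega> \<psi> \<and> realises R \<tau> \<omega> \<psi>'}"
  let ?f = "(fact (half_edge_total - 2 * card (tverts - {[]})) / fact half_edge_total :: real)"
  have finD: "finite ?D" by (rule finite_subset[of _ "plcs \<times> plcs"]) (auto simp: finite_placements)
  have bound: "(real (card (occs \<omega>)))\<^sup>2 \<le> (\<Sum>x\<in>?D. indicator (?A x) \<omega>) + (real (card tverts))\<^sup>2 * N"
    if \<omega>: "\<omega> \<in> matchings N M dl Com" for \<omega>
  proof -
    let ?O = "occs \<omega>"
    have eq: "?O \<times> ?O = {x \<in> ?D. \<omega> \<in> ?A x} \<union> (SIGMA \<psi>:?O. {\<psi>' \<in> ?O. \<psi> ` tverts \<inter> \<psi>' ` tverts \<noteq> {}})"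
      by (auto simp: occurrences_def)
    have "(card ?O)\<^sup>2 = card (?O \<times> ?O)" by (simp add: card_cartesian_product power2_eq_square)
    also have "\<dots> \<le> card {x \<in> ?D. \<omega> \<in> ?A x} + card (SIGMA \<psi>:?O. {\<psi>' \<in> ?O. \<psi> ` tverts \<inter> \<psi>' ` tverts \<noteq> {}})"
      unfolding eq by (rule card_Un_le)
    also have "card (SIGMA \<psi>:?O. {\<psi>' \<in> ?O. \<psi> ` tverts \<inter> \<psi>' ` tverts \<noteq> {}}) =
        (\<Sum>\<psi>\<in>?O. card {\<psi>' \<in> ?O. \<psi> ` tverts \<inter> \<psi>' ` tverts \<noteq> {}})"
      by (rule card_SigmaI) (auto simp: finite_occurrences)
    also have "\<dots> \<le> (\<Sum>\<psi>\<in>?O. (card tverts)\<^sup>2)" by (intro sum_mono card_overlapping_le \<omega>)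
    also have "\<dots> \<le> (card tverts)\<^sup>2 * N" using card_occurrences_le[OF \<omega>] by simp
    finally have "(card ?O)\<^sup>2 \<le> card {x \<in> ?D. \<omega> \<in> ?A x} + (card tverts)\<^sup>2 * N" by simp
    then have "(real (card ?O))\<^sup>2 \<le> real (card {x \<in> ?D. \<omega> \<in> ?A x}) + (real (card tverts))\<^sup>2 * N"
      unfolding of_nat_le_iff[where 'a = real, symmetric] by (simp only: of_nat_add of_nat_mult of_nat_power)
    also have "real (card {x \<in> ?D. \<omega> \<in> ?A x}) = (\<Sum>x\<in>?D. indicator (?A x) \<omega>)"
      using finD by (simp add: indicator_def sum.If_cases Int_def)
    finally show ?thesis .
  qed
  have "?E (\<lambda>\<omega>. (real (card (occs \<omega>)))\<^sup>2) \<le> ?E (\<lambda>\<omega>. (\<Sum>x\<in>?D. indicator (?A x) \<omega>) + (real (card tverts))\<^sup>2 * N)"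
    by (intro integral_mono_AE integrable_matching_pmf AE_pmfI bound) (simp add: set_matching_pmf)
  also have "\<dots> = (\<Sum>x\<in>?D. measure_pmf.prob (matching_pmf N M dl Com) (?A x)) + (real (card tverts))\<^sup>2 * N"
    by (simp add: Bochner_Integration.integral_add Bochner_Integration.integral_sum integrable_matching_pmf)
  also have "(\<Sum>x\<in>?D. measure_pmf.prob (matching_pmf N M dl Com) (?A x)) = (\<Sum>x\<in>?D. ?f)"
    by (intro sum.cong refl) (auto simp: prob_realises_disjoint)
  also have "\<dots> = real (card ?D) * ?f" by simp
  also have "\<dots> \<le> (real (card plcs))\<^sup>2 * ?f"
  proof (rule mult_right_mono)
    have "card ?D \<le> card (plcs \<times> plcs)" by (rule card_mono) (auto simp: finite_placements)
    then show "real (card ?D) \<le> (real (card plcs))\<^sup>2"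
      unfolding of_nat_le_iff[where 'a = real, symmetric]
      by (simp only: card_cartesian_product of_nat_mult power2_eq_square)
  qed simp
  finally show ?thesis by simp
qed

end

end


section \<open>The law of the limit tree\<close>

text \<open>\<open>embed_pmf\<close> has the given masses only if these sum to 1. Shifting the index
  by one loses just the term of 0, which vanishes, so the sum before normalisation is the
  mean.\<close>

lemma pmf_size_biased:
  assumes int: "integrable (measure_pmf X) real" and pos: "measure_pmf.expectation X real > 0"
  shows "pmf (size_biased X) k = real (k + 1) * pmf X (k + 1) / measure_pmf.expectation X real"
proof -
  let ?E = "measure_pmf.expectation X real"
  have "(\<integral>\<^sup>+ k. ennreal (real (k + 1) * pmf X (k + 1)) \<partial>count_space UNIV) =
      (\<integral>\<^sup>+ k. ennreal (real k * pmf X k) \<partial>count_space {1..})"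
  proof -
    have "bij_betw Suc UNIV {1..}"
      by (rule bij_betw_byWitness[where f' = "\<lambda>n. n - 1"]) auto
    from nn_integral_bij_count_space[OF this, of "\<lambda>k. ennreal (real k * pmf X k)"] show ?thesis by simp
  qed
  also have "\<dots> = (\<integral>\<^sup>+ k. ennreal (real k * pmf X k) \<partial>count_space UNIV)"
    by (rule nn_integral_count_space_eq) (auto simp: not_le)
  also have "\<dots> = (\<integral>\<^sup>+ k. ennreal (real k) \<partial>measure_pmf X)"
    by (simp add: nn_integral_measure_pmf ennreal_mult'' mult.commute)
  also have "\<dots> = ennreal ?E" by (rule nn_integral_eq_integral[OF int]) simp
  finally have sum: "(\<integral>\<^sup>+ k. ennreal (real (k + 1) * pmf X (k + 1)) \<partial>count_space UNIV) = ennreal ?E" .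
  have "(\<integral>\<^sup>+ k. ennreal (real (k + 1) * pmf X (k + 1) / ?E) \<partial>count_space UNIV) =
      (\<integral>\<^sup>+ k. ennreal (real (k + 1) * pmf X (k + 1)) * ennreal (1 / ?E) \<partial>count_space UNIV)"
    using pos by (intro nn_integral_cong) (simp flip: ennreal_mult'')
  also have "\<dots> = ennreal ?E * ennreal (1 / ?E)"
    by (subst nn_integral_multc) (simp_all only: sum borel_measurable_count_space)
  also have "\<dots> = 1" using pos by (simp flip: ennreal_mult'')
  finally show ?thesis
    unfolding size_biased_def using pos by (subst pmf_embed_pmf) auto
qed

lemma pmf_bind_single:
  assumes "\<And>x. x \<noteq> k \<Longrightarrow> pmf (f x) y = 0"
  shows "pmf (bind_pmf X f) y = pmf X k * pmf (f k) y"
proof -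
  have eq: "pmf (f x) y = indicator {k} x * pmf (f k) y" for x
    using assms[of x] by (cases "x = k") auto
  have "pmf (bind_pmf X f) y = (\<integral>x. indicator {k} x * pmf (f k) y \<partial>measure_pmf X)"
    unfolding pmf_bind by (rule Bochner_Integration.integral_cong[OF refl eq])
  then show ?thesis by (simp add: measure_pmf_single)
qed

definition good_label :: "cgraph pmf \<Rightarrow> nat list \<Rightarrow> label \<Rightarrow> bool" where
  "good_label \<mu> u l \<longleftrightarrow> proper_label u l \<and> (odd (length u) \<longrightarrow> the (community l) \<in> set_pmf \<mu>)"

text \<open>What remains of \<open>label_pmf\<close> after cancellation: the uniform parent mark
  contributes 1 / (k + 1) against the size bias k + 1, and for a community the probability of size k
  + 1 cancels against the conditioning. Off the root this is the limit of the number of candidates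
  over h, since h / N and h / M tend to the two means.\<close>

definition label_weight :: "nat pmf \<Rightarrow> cgraph pmf \<Rightarrow> nat list \<Rightarrow> label \<Rightarrow> real" where
  "label_weight p \<mu> u l =
     (if u = [] then pmf p (nchildren l)
      else if even (length u) then pmf p (nchildren l + 1) / measure_pmf.expectation p real
      else pmf \<mu> (the (community l)) / measure_pmf.expectation (map_pmf csize \<mu>) real)"

lemma good_labelE:
  assumes "good_label \<mu> u l"
  obtains (root) k where "u = []" "l = Label k None 0"
  | (individual) k K where "u \<noteq> []" "even (length u)" "l = Label k None K" "K \<in> {1..k + 1}"
  | (comm) k H K where "odd (length u)" "l = Label k (Some H) K" "K \<in> {1..k + 1}"
      "csize H = k + 1" "H \<in> set_pmf \<mu>" "community_graph H"
proof (cases l)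
  case (Label k c K)
  with assms that show ?thesis
    by (cases "u = []"; cases "even (length u)") (auto simp: good_label_def proper_label_def)
qed

context
  fixes p :: "nat pmf" and \<mu> :: "cgraph pmf"
  assumes p_int: "integrable (measure_pmf p) real"
    and p_pos: "measure_pmf.expectation p real > 0"
    and \<mu>_int: "integrable (measure_pmf (map_pmf csize \<mu>)) real"
    and \<mu>_pos: "measure_pmf.expectation (map_pmf csize \<mu>) real > 0"
    and \<mu>_comm: "\<And>H. H \<in> set_pmf \<mu> \<Longrightarrow> community_graph H"
begin

lemma pmf_label_pmf:
  assumes "good_label \<mu> u l"
  shows "pmf (label_pmf p \<mu> u) l = label_weight p \<mu> u l"
  using assms
proof (cases rule: good_labelE)
  case (root k)
  have "inj (\<lambda>k. Label k None 0)" by (auto simp: inj_def)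
  with root pmf_map_inj'[of "\<lambda>k. Label k None 0" p k] show ?thesis
    by (simp add: label_pmf_def label_weight_def)
next
  case (individual k K)
  have eq: "pmf (pmf_of_set {1..k' + 1} \<bind> (\<lambda>K'. return_pmf (Label k' None K'))) l =
      pmf (pmf_of_set {1..k' + 1}) K * of_bool (k' = k)" for k'
    using individual by (subst pmf_bind_single[of K]) (auto simp: indicator_def)
  have mismatch: "pmf (pmf_of_set {1..x + 1} \<bind> (\<lambda>K'. return_pmf (Label x None K'))) l = 0" if "x \<noteq> k" for x
    unfolding eq using that by simp
  have lp: "label_pmf p \<mu> u = size_biased p \<bind> (\<lambda>k'. pmf_of_set {1..k' + 1} \<bind> (\<lambda>K'. return_pmf (Label k' None K')))"
    using individual by (simp add: label_pmf_def)
  have "pmf (label_pmf p \<mu> u) l =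
      pmf (size_biased p) k * pmf (pmf_of_set {1..k + 1} \<bind> (\<lambda>K'. return_pmf (Label k None K'))) l"
    unfolding lp by (rule pmf_bind_single[OF mismatch])
  also have "\<dots> = pmf (size_biased p) k * (1 / real (k + 1))"
    unfolding eq using individual by simp
  finally show ?thesis
    using individual by (simp add: pmf_size_biased[OF p_int p_pos] label_weight_def)
next
  case (comm k H K)
  let ?Q = "map_pmf csize \<mu>"
  let ?S = "{H. csize H = k + 1}"
  have ne: "set_pmf \<mu> \<inter> ?S \<noteq> {}" using comm by auto
  have eqK: "pmf (pmf_of_set {1..k' + 1} \<bind> (\<lambda>K'. return_pmf (Label k' (Some H') K'))) l =
      pmf (pmf_of_set {1..k' + 1}) K * of_bool (k' = k \<and> H' = H)" for k' H'
    using comm by (subst pmf_bind_single[of K]) (auto simp: indicator_def)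
  have eqH: "pmf (X \<bind> (\<lambda>H'. pmf_of_set {1..k' + 1} \<bind> (\<lambda>K'. return_pmf (Label k' (Some H') K')))) l =
      pmf X H * (pmf (pmf_of_set {1..k' + 1}) K * of_bool (k' = k))" for k' X
    by (subst pmf_bind_single[of H]) (auto simp: eqK[simplified])
  let ?f = "\<lambda>k'. cond_pmf \<mu> {H. csize H = k' + 1} \<bind>
      (\<lambda>H'. pmf_of_set {1..k' + 1} \<bind> (\<lambda>K'. return_pmf (Label k' (Some H') K')))"
  have mismatch: "pmf (?f x) l = 0" if "x \<noteq> k" for x
    unfolding eqH using that by simp
  have lp: "label_pmf p \<mu> u = size_biased ?Q \<bind> ?f" using comm by (auto simp: label_pmf_def)
  have "pmf (label_pmf p \<mu> u) l = pmf (size_biased ?Q) k * pmf (?f k) l"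
    unfolding lp by (rule pmf_bind_single[OF mismatch])
  also have "\<dots> = pmf (size_biased ?Q) k * (pmf (cond_pmf \<mu> ?S) H * (1 / real (k + 1)))"
    unfolding eqH using comm by simp
  finally have "pmf (label_pmf p \<mu> u) l =
      pmf (size_biased ?Q) k * (pmf (cond_pmf \<mu> ?S) H * (1 / real (k + 1)))" .
  moreover have "pmf ?Q (k + 1) = measure_pmf.prob \<mu> ?S"
    by (simp add: pmf_map vimage_def)
  moreover have "measure_pmf.prob \<mu> ?S > 0"
    using comm by (intro measure_pmf_posI[of H]) auto
  moreover have "pmf (cond_pmf \<mu> ?S) H = pmf \<mu> H / measure_pmf.prob \<mu> ?S"
    unfolding pmf_cond[OF ne] using comm by simp
  ultimately show ?thesis
    using comm by (auto simp: pmf_size_biased[OF \<mu>_int \<mu>_pos] label_weight_def)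
qed

lemma set_label_pmf: "l \<in> set_pmf (label_pmf p \<mu> u) \<Longrightarrow> good_label \<mu> u l"
proof -
  assume l: "l \<in> set_pmf (label_pmf p \<mu> u)"
  consider "u = []" | "u \<noteq> []" "even (length u)" | "odd (length u)" by blast
  then show ?thesis
  proof cases
    case 1
    with l show ?thesis by (auto simp: label_pmf_def good_label_def proper_label_def)
  next
    case 2
    with l show ?thesis by (auto simp: label_pmf_def good_label_def proper_label_def)
  next
    case 3
    then have "u \<noteq> []" by auto
    with 3 l obtain k H K where k: "k \<in> set_pmf (size_biased (map_pmf csize \<mu>))"
      and H: "H \<in> set_pmf (cond_pmf \<mu> {H. csize H = k + 1})" and K: "K \<in> {1..k + 1}"
      and l': "l = Label k (Some H) K"
      by (auto simp: label_pmf_def)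
    \<comment> \<open>\<open>cond_pmf\<close> is meaningful only for an event of positive
      probability; the size-biased law charges only those k for which this holds.\<close>
    have "pmf (map_pmf csize \<mu>) (k + 1) \<noteq> 0"
      using k by (auto simp: set_pmf_iff pmf_size_biased[OF \<mu>_int \<mu>_pos])
    then have "set_pmf \<mu> \<inter> {H. csize H = k + 1} \<noteq> {}" by (auto simp flip: set_pmf_iff)
    then have "H \<in> set_pmf \<mu>" "csize H = k + 1" using H by auto
    with l' K 3 \<mu>_comm \<open>u \<noteq> []\<close> show ?thesis by (auto simp: good_label_def proper_label_def)
  qed
qed

end


section \<open>Finite truncations and countability\<close>

definition truncated :: "nat \<Rightarrow> (nat list \<Rightarrow> label) \<Rightarrow> nat list \<Rightarrow> label" where
  "truncated R \<tau> = (\<lambda>u. if u \<in> tree_ball R \<tau> then \<tau> u else Label 0 None 0)"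

lemma truncated_in_ball: "u \<in> tree_ball R \<tau> \<Longrightarrow> truncated R \<tau> u = \<tau> u"
  by (simp add: truncated_def)

lemma tree_ball_truncated: "tree_ball R (truncated R \<tau>) = tree_ball R \<tau>"
  by (rule tree_ball_agree) (rule truncated_in_ball)

text \<open>This is the purpose of the fixed label outside the ball: having the same first R
  generations becomes equality of functions, and a type is a value of
  \<open>truncated\<close>.\<close>

lemma truncated_eq_iff:
  "truncated R \<tau>' = truncated R \<tau> \<longleftrightarrow> (\<forall>u\<in>tree_ball R \<tau>. \<tau>' u = \<tau> u)"
proof
  assume eq: "truncated R \<tau>' = truncated R \<tau>"
  show "\<forall>u\<in>tree_ball R \<tau>. \<tau>' u = \<tau> u"
  proof
    fix u assume u: "u \<in> tree_ball R \<tau>"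
    moreover have "tree_ball R \<tau>' = tree_ball R \<tau>" using eq tree_ball_truncated by metis
    ultimately show "\<tau>' u = \<tau> u" using fun_cong[OF eq, of u] by (simp add: truncated_def)
  qed
next
  assume agree: "\<forall>u\<in>tree_ball R \<tau>. \<tau>' u = \<tau> u"
  then have "tree_ball R \<tau>' = tree_ball R \<tau>" by (intro tree_ball_agree) blast
  with agree show "truncated R \<tau>' = truncated R \<tau>" by (auto simp: truncated_def fun_eq_iff)
qed

lemma truncated_truncated: "truncated R (truncated R \<tau>) = truncated R \<tau>"
  by (simp add: truncated_eq_iff truncated_in_ball)

lemma nbhd_CP_truncated:
  "nbhd r (CP (truncated (2 * r + 1) \<tau>)) [] \<simeq>\<^sub>r S \<longleftrightarrow> nbhd r (CP \<tau>) [] \<simeq>\<^sub>r S"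
proof -
  have "nbhd r (CP \<tau>) [] \<simeq>\<^sub>r nbhd r (CP (truncated (2 * r + 1) \<tau>)) []"
    by (rule nbhd_CP_local) (rule truncated_in_ball)
  moreover have "snd (nbhd r (CP \<tau>) []) \<in> verts (fst (nbhd r (CP \<tau>) []))"
    by (rule root_in_nbhd) (simp add: CP_def)
  ultimately show ?thesis by (rule rooted_iso_cong[symmetric])
qed

lemma countable_truncated:
  assumes "countable L"
  shows "countable {truncated R \<tau> | \<tau>. \<forall>u\<in>tree_ball R \<tau>. \<tau> u \<in> L}"
proof (rule countable_subset)
  let ?X = "\<Union>I\<in>{I. finite I}. (\<lambda>f u. if u \<in> I then f u else Label 0 None 0) ` (PiE I (\<lambda>_ :: nat list. L))"
  show "countable ?X"
    by (intro countable_UN countable_Collect_finite countable_image countable_PiE assms) auto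
  show "{truncated R \<tau> | \<tau>. \<forall>u\<in>tree_ball R \<tau>. \<tau> u \<in> L} \<subseteq> ?X"
  proof clarify
    fix \<tau> assume \<tau>: "\<forall>u\<in>tree_ball R \<tau>. \<tau> u \<in> L"
    have "truncated R \<tau> = (\<lambda>u. if u \<in> tree_ball R \<tau> then restrict \<tau> (tree_ball R \<tau>) u else Label 0 None 0)"
      by (auto simp: truncated_def)
    moreover have "restrict \<tau> (tree_ball R \<tau>) \<in> PiE (tree_ball R \<tau>) (\<lambda>_. L)" using \<tau> by auto
    ultimately show "truncated R \<tau> \<in> ?X" using finite_tree_ball by blast
  qed
qed


text \<open>
  There are uncountably many labels, and the product \<open>\<sigma>\<close>-algebra of the discrete ones need not
  contain every event depending on finitely many of them.  But \<open>CP\<close> uses only finitely many of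
  the edges of a community graph, so its law lives on the countably many clipped labels.
\<close>

definition clip :: "label \<Rightarrow> label" where
  "clip l = Label (nchildren l)
     (Some \<lparr>csize = 0,
        cedges = {f \<in> cedges (the (community l)). set_uprod f \<subseteq> insert (parent_mark l) {1..nchildren l + 1}}\<rparr>)
     (parent_mark l)"

lemma countable_range_clip: "countable (range clip)"
proof -
  have "countable (UNIV :: nat uprod set)"
  proof -
    have "(UNIV :: nat uprod set) = range (\<lambda>(x, y). Upair x y)"
      by (auto simp: image_iff) (metis uprod_exhaust)
    then show ?thesis by (metis countable_image countableI_type)
  qed
  then have F: "countable {A :: nat uprod set. finite A \<and> A \<subseteq> UNIV}"
    by (rule countable_Collect_finite_subset)
  let ?g = "\<lambda>(n, A, m). Label n (Some \<lparr>csize = 0, cedges = A\<rparr>) m"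
  have "range clip \<subseteq> ?g ` (UNIV \<times> {A. finite A \<and> A \<subseteq> UNIV} \<times> UNIV)"
  proof
    fix c assume "c \<in> range clip"
    then obtain l where c: "c = clip l" by blast
    let ?B = "insert (parent_mark l) {1..nchildren l + 1}"
    have "{f. set_uprod f \<subseteq> ?B} \<subseteq> (\<lambda>(x, y). Upair x y) ` (?B \<times> ?B)"
    proof
      fix f assume "f \<in> {f. set_uprod f \<subseteq> ?B}"
      then show "f \<in> (\<lambda>(x, y). Upair x y) ` (?B \<times> ?B)" by (cases f) auto
    qed
    then have "finite {f. set_uprod f \<subseteq> ?B}" by (rule finite_subset) simp
    then have "finite {f \<in> cedges (the (community l)). set_uprod f \<subseteq> ?B}" by (rule rev_finite_subset) auto
    then show "c \<in> ?g ` (UNIV \<times> {A. finite A \<and> A \<subseteq> UNIV} \<times> UNIV)"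
      using c by (intro image_eqI[of _ _ "(nchildren l, {f \<in> cedges (the (community l)). set_uprod f \<subseteq> ?B}, parent_mark l)"])
        (auto simp: clip_def)
  qed
  moreover have "countable (?g ` (UNIV \<times> {A. finite A \<and> A \<subseteq> UNIV} \<times> UNIV))"
    by (intro countable_image countable_SIGMA F) auto
  ultimately show ?thesis by (rule countable_subset)
qed

text \<open>Stated for all labellings, also those outside the support, whose parent mark may exceed
  the degree; this is why \<open>clip\<close> inserts it. Removing one mark from the k + 1 at a
  non-root vertex leaves at least k for the children.\<close>

lemma joined_mark:
  assumes "joined \<tau> a k w" "a \<noteq> []"
  shows "k \<in> insert (parent_mark (\<tau> a)) {1..nchildren (\<tau> a) + 1}"
proof -
  have "child_marks \<tau> a ! i \<in> {1..nchildren (\<tau> a) + 1}" if "i < nchildren (\<tau> a)" for i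
  proof -
    have "nchildren (\<tau> a) \<le> card ({1..tree_degree \<tau> a} - {parent_mark (\<tau> a)})"
      using assms(2) by (simp add: tree_degree_def card_Diff_singleton_if)
    then have "child_marks \<tau> a ! i \<in> set (child_marks \<tau> a)"
      using that by (intro nth_mem) (simp add: child_marks_def)
    then show ?thesis using assms(2) by (simp add: set_child_marks tree_degree_def)
  qed
  with assms show ?thesis by (auto simp: joined_def)
qed

lemma CP_clip: "CP (clip \<circ> \<tau>) = CP \<tau>"
proof -
  have tree: "bp_tree (clip \<circ> \<tau>) = bp_tree \<tau>" by (simp add: bp_tree_def clip_def)
  have j: "joined (clip \<circ> \<tau>) a k w = joined \<tau> a k w" for a k w
    by (simp add: joined_def child_marks_def tree_degree_def clip_def)
  have "a \<in> bp_tree \<tau> \<and> odd (length a) \<and> f \<in> cedges (the (community ((clip \<circ> \<tau>) a))) \<and>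
      (\<exists>k k' w w'. f = Upair k k' \<and> joined \<tau> a k w \<and> joined \<tau> a k' w' \<and> e = Upair w w') \<longleftrightarrow>
    a \<in> bp_tree \<tau> \<and> odd (length a) \<and> f \<in> cedges (the (community (\<tau> a))) \<and>
      (\<exists>k k' w w'. f = Upair k k' \<and> joined \<tau> a k w \<and> joined \<tau> a k' w' \<and> e = Upair w w')" for a f e
    using joined_mark[of \<tau> a] by (fastforce simp: clip_def)
  then show ?thesis by (simp only: CP_def tree j)
qed

section \<open>Probabilities of events that depend on finitely many generations\<close>

context
  fixes p :: "nat pmf" and \<mu> :: "cgraph pmf"
begin

interpretation bp: product_prob_space "\<lambda>u. measure_pmf (label_pmf p \<mu> u)" UNIV
  by unfold_locales

lemma prob_space_bp: "prob_space (bp_space p \<mu>)"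
  unfolding bp_space_def by (rule bp.prob_space_axioms)

lemma space_bp [simp]: "space (bp_space p \<mu>) = UNIV"
  by (simp add: bp_space_def space_PiM)

lemma measurable_coordinate: "{\<tau>. \<tau> u \<in> A} \<in> sets (bp_space p \<mu>)"
proof -
  have "(\<lambda>\<tau>. \<tau> u) -` A \<inter> space (PiM UNIV (\<lambda>u. measure_pmf (label_pmf p \<mu> u)))
      \<in> sets (PiM UNIV (\<lambda>u. measure_pmf (label_pmf p \<mu> u)))"
    by (rule measurable_sets[OF measurable_component_singleton]) auto
  then show ?thesis by (simp add: bp_space_def space_PiM vimage_def)
qed

lemma measurable_cylinder: "finite I \<Longrightarrow> {\<tau>. \<forall>u\<in>I. \<tau> u \<in> A u} \<in> sets (bp_space p \<mu>)"
proof (induction I rule: finite_induct)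
  case empty
  then show ?case using sets.top[of "bp_space p \<mu>"] by simp
next
  case (insert u I)
  have "{\<tau>. \<forall>u\<in>insert u I. \<tau> u \<in> A u} = {\<tau>. \<tau> u \<in> A u} \<inter> {\<tau>. \<forall>u\<in>I. \<tau> u \<in> A u}" by auto
  then show ?case using insert.IH measurable_coordinate by (simp add: sets.Int)
qed

lemma prob_cylinder:
  assumes "finite I"
  shows "measure (bp_space p \<mu>) {\<tau>. \<forall>u\<in>I. \<tau> u = t u} = (\<Prod>u\<in>I. pmf (label_pmf p \<mu> u) (t u))"
proof -
  have "emeasure (bp_space p \<mu>) {\<tau>. \<forall>u\<in>I. \<tau> u = t u} = (\<Prod>u\<in>I. emeasure (measure_pmf (label_pmf p \<mu> u)) {t u})"
    using bp.emeasure_PiM_Collect[OF _ assms, of "\<lambda>u. {t u}"] by (simp add: bp_space_def space_PiM)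
  then show ?thesis by (simp add: measure_def emeasure_pmf_single prod_ennreal prod_nonneg)
qed

text \<open>The event is a union of fibres of the truncated clipped labelling. There are countably
  many fibres, and each is a cylinder over a finite ball.\<close>

lemma measurable_nbhd_CP: "{\<tau>. nbhd r (CP \<tau>) [] \<simeq>\<^sub>r S} \<in> sets (bp_space p \<mu>)"
proof -
  let ?R = "2 * r + 1"
  let ?C = "{truncated ?R \<tau> | \<tau>. \<forall>u\<in>tree_ball ?R \<tau>. \<tau> u \<in> range clip}"
  have "{\<tau>. nbhd r (CP \<tau>) [] \<simeq>\<^sub>r S} =
      (\<Union>t\<in>{t \<in> ?C. nbhd r (CP t) [] \<simeq>\<^sub>r S}. {\<tau>. truncated ?R (clip \<circ> \<tau>) = t})" (is "?A = ?B")
  proof (intro equalityI subsetI)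
    fix \<tau> assume "\<tau> \<in> ?A"
    then have "nbhd r (CP (truncated ?R (clip \<circ> \<tau>))) [] \<simeq>\<^sub>r S"
      by (simp only: nbhd_CP_truncated CP_clip mem_Collect_eq)
    moreover have "truncated ?R (clip \<circ> \<tau>) \<in> ?C" by auto
    ultimately show "\<tau> \<in> ?B" by blast
  next
    fix \<tau> assume "\<tau> \<in> ?B"
    then have "nbhd r (CP (truncated ?R (clip \<circ> \<tau>))) [] \<simeq>\<^sub>r S" by auto
    then show "\<tau> \<in> ?A" by (simp only: nbhd_CP_truncated CP_clip mem_Collect_eq)
  qed
  moreover have "?B \<in> sets (bp_space p \<mu>)"
  proof (rule sets.countable_UN'')
    show "countable {t \<in> ?C. nbhd r (CP t) [] \<simeq>\<^sub>r S}"
      by (rule countable_subset[OF _ countable_truncated[OF countable_range_clip]]) auto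
    show "{\<tau>. truncated ?R (clip \<circ> \<tau>) = t} \<in> sets (bp_space p \<mu>)"
      if t: "t \<in> {t \<in> ?C. nbhd r (CP t) [] \<simeq>\<^sub>r S}" for t
    proof -
      obtain \<tau>0 where "t = truncated ?R \<tau>0" using t by blast
      then have "{\<tau>. truncated ?R (clip \<circ> \<tau>) = t} = {\<tau>. \<forall>u\<in>tree_ball ?R \<tau>0. \<tau> u \<in> clip -` {\<tau>0 u}}"
        by (simp add: truncated_eq_iff)
      then show ?thesis by (simp only: measurable_cylinder finite_tree_ball)
    qed
  qed
  ultimately show ?thesis by (simp only:)
qed

lemma prob_truncated:
  "{\<tau>. truncated R \<tau> = truncated R t} \<in> sets (bp_space p \<mu>)"
  "measure (bp_space p \<mu>) {\<tau>. truncated R \<tau> = truncated R t} =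
     (\<Prod>u\<in>tree_ball R t. pmf (label_pmf p \<mu> u) (t u))"
  using measurable_cylinder[OF finite_tree_ball, of R t "\<lambda>u. {t u}"] prob_cylinder[OF finite_tree_ball, of R t t]
  by (simp_all add: truncated_eq_iff)

definition good_trees :: "nat \<Rightarrow> (nat list \<Rightarrow> label) set" where
  "good_trees R = {truncated R \<tau> | \<tau>. \<forall>u\<in>tree_ball R \<tau>. good_label \<mu> u (\<tau> u)}"

lemma good_treesD:
  assumes "t \<in> good_trees R"
  shows "truncated R t = t" and "u \<in> tree_ball R t \<Longrightarrow> good_label \<mu> u (t u)"
  using assms by (auto simp: good_trees_def truncated_truncated tree_ball_truncated truncated_in_ball)

lemma countable_good_trees: "countable (good_trees R)"
proof (rule countable_subset)
  let ?L = "(\<lambda>(n, c, m). Label n c m) ` (UNIV \<times> insert None (Some ` set_pmf \<mu>) \<times> UNIV)"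
  have "good_label \<mu> u l \<Longrightarrow> l \<in> ?L" for u l
    by (erule good_labelE) (auto simp: image_iff)
  then show "good_trees R \<subseteq> {truncated R \<tau> | \<tau>. \<forall>u\<in>tree_ball R \<tau>. \<tau> u \<in> ?L}"
    unfolding good_trees_def by blast
  show "countable {truncated R \<tau> | \<tau>. \<forall>u\<in>tree_ball R \<tau>. \<tau> u \<in> ?L}"
    by (intro countable_truncated countable_image countable_SIGMA countable_insert) auto
qed

text \<open>Almost surely all labels are good, so the countably many good truncations carry mass 1.
  Continuity from below along an enumeration yields finitely many that carry almost all of
  it.\<close>

lemma good_trees_exhaust:
  assumes supp: "\<And>u l. l \<in> set_pmf (label_pmf p \<mu> u) \<Longrightarrow> good_label \<mu> u l" and "\<epsilon> > 0"
  shows "\<exists>S. finite S \<and> S \<subseteq> good_trees R \<and>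
    measure (bp_space p \<mu>) (\<Union>t\<in>S. {\<tau>. truncated R \<tau> = t}) > 1 - \<epsilon>"
proof -
  interpret P: prob_space "bp_space p \<mu>" by (rule prob_space_bp)
  have "AE \<tau> in bp_space p \<mu>. good_label \<mu> u (\<tau> u)" for u
    unfolding bp_space_def
    by (rule AE_PiM_component) (auto intro: prob_space_measure_pmf AE_pmfI supp)
  then have "AE \<tau> in bp_space p \<mu>. \<forall>u. good_label \<mu> u (\<tau> u)" by (simp add: AE_all_countable)
  then have AE: "AE \<tau> in bp_space p \<mu>. truncated R \<tau> \<in> good_trees R"
    by (rule AE_mp) (auto simp: good_trees_def)
  then have ne: "good_trees R \<noteq> {}"
    using P.AE_False by (auto simp: P.prob_space_axioms)
  define g where "g = from_nat_into (good_trees R)"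
  have range: "range g = good_trees R"
    unfolding g_def by (rule range_from_nat_into[OF ne countable_good_trees])
  define A where "A n = (\<Union>t\<in>g ` {..<n}. {\<tau>. truncated R \<tau> = t})" for n
  have meas: "{\<tau>. truncated R \<tau> = g i} \<in> sets (bp_space p \<mu>)" for i
  proof -
    have "g i \<in> good_trees R" using range by blast
    from good_treesD(1)[OF this] prob_truncated(1)[of R "g i"] show ?thesis by simp
  qed
  have A: "A n \<in> sets (bp_space p \<mu>)" for n
    unfolding A_def using meas by (intro sets.finite_UN) auto
  have "incseq A" unfolding incseq_def A_def by (intro allI impI UN_mono image_mono) auto
  then have lim: "(\<lambda>n. measure (bp_space p \<mu>) (A n)) \<longlonglongrightarrow> measure (bp_space p \<mu>) (\<Union>n. A n)"
    using A by (intro P.finite_Lim_measure_incseq) auto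
  have "(\<Union>n. A n) = {\<tau>. truncated R \<tau> \<in> good_trees R}"
    unfolding range[symmetric] by (auto simp: A_def)
  moreover have "measure (bp_space p \<mu>) {\<tau>. truncated R \<tau> \<in> good_trees R} = 1"
  proof -
    have "{\<tau>. truncated R \<tau> \<in> good_trees R} \<in> sets (bp_space p \<mu>)"
      unfolding calculation[symmetric] using A by (intro sets.countable_UN) auto
    from P.prob_eq_1[OF this] AE show ?thesis by simp
  qed
  ultimately have "(\<lambda>n. measure (bp_space p \<mu>) (A n)) \<longlonglongrightarrow> 1" using lim by simp
  then have "eventually (\<lambda>n. measure (bp_space p \<mu>) (A n) > 1 - \<epsilon>) sequentially"
    using \<open>\<epsilon> > 0\<close> by (intro order_tendstoD) auto
  then obtain n where "measure (bp_space p \<mu>) (A n) > 1 - \<epsilon>"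
    by (auto simp: eventually_sequentially)
  then show ?thesis
    by (intro exI[of _ "g ` {..<n}"]) (auto simp: A_def simp flip: range)
qed

lemma prob_tree_event:
  assumes S: "finite S" "S \<subseteq> good_trees R"
  shows "(\<Union>t\<in>S. {\<tau>. truncated R \<tau> = t}) \<in> sets (bp_space p \<mu>)"
    and "measure (bp_space p \<mu>) (\<Union>t\<in>S. {\<tau>. truncated R \<tau> = t}) =
      (\<Sum>t\<in>S. \<Prod>u\<in>tree_ball R t. pmf (label_pmf p \<mu> u) (t u))"
proof -
  interpret P: prob_space "bp_space p \<mu>" by (rule prob_space_bp)
  have t: "truncated R t = t" if "t \<in> S" for t using S good_treesD(1) that by blast
  have meas: "{\<tau>. truncated R \<tau> = t} \<in> sets (bp_space p \<mu>)" if "t \<in> S" for t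
    using prob_truncated(1)[of R t] t[OF that] by simp
  then show "(\<Union>t\<in>S. {\<tau>. truncated R \<tau> = t}) \<in> sets (bp_space p \<mu>)" using S by (intro sets.finite_UN)
  have "measure (bp_space p \<mu>) (\<Union>t\<in>S. {\<tau>. truncated R \<tau> = t}) =
      (\<Sum>t\<in>S. measure (bp_space p \<mu>) {\<tau>. truncated R \<tau> = t})"
    using meas by (intro P.finite_measure_finite_Union S) (auto simp: disjoint_family_on_def)
  also have "\<dots> = (\<Sum>t\<in>S. \<Prod>u\<in>tree_ball R t. pmf (label_pmf p \<mu> u) (t u))"
  proof (rule sum.cong[OF refl])
    fix t' assume "t' \<in> S"
    from prob_truncated(2)[of R t'] t[OF this]
    show "measure (bp_space p \<mu>) {\<tau>. truncated R \<tau> = t'} =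
        (\<Prod>u\<in>tree_ball R t'. pmf (label_pmf p \<mu> u) (t' u))" by simp
  qed
  finally show "measure (bp_space p \<mu>) (\<Union>t\<in>S. {\<tau>. truncated R \<tau> = t}) =
      (\<Sum>t\<in>S. \<Prod>u\<in>tree_ball R t. pmf (label_pmf p \<mu> u) (t u))" .
qed

end


section \<open>Asymptotics\<close>

text \<open>Weak convergence controls distribution functions only at continuity points. A
  half-integer is one for every law on the naturals.\<close>

lemma prob_of_nat_cdf:
  "cdf (distr (measure_pmf X) borel real) (real k + 1 / 2) = measure_pmf.prob X {..k}"
proof -
  have "real -` {..real k + 1 / 2} = {..k}" by auto
  then show ?thesis by (simp add: cdf_def measure_distr)
qed

lemma converges_in_distribution_prob_atMost:
  assumes "converges_in_distribution X Y"
  shows "(\<lambda>n. measure_pmf.prob (X n) {..k}) \<longlonglongrightarrow> measure_pmf.prob Y {..k}"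
proof -
  let ?D = "distr (measure_pmf Y) borel real"
  interpret real_distribution ?D
    by (rule prob_space.real_distribution_distr[OF prob_space_measure_pmf]) simp
  have "real j \<noteq> real k + 1 / 2" for j
  proof
    assume "real j = real k + 1 / 2"
    then have "real (2 * j) = real (2 * k + 1)" by simp
    then have "2 * j = 2 * k + 1" by (simp only: of_nat_eq_iff)
    then show False by presburger
  qed
  then have "real -` {real k + 1 / 2} = {}" by auto
  then have "measure ?D {real k + 1 / 2} = 0" by (simp add: measure_distr)
  then have "isCont (cdf ?D) (real k + 1 / 2)" by (simp add: isCont_cdf)
  then have "(\<lambda>n. cdf (distr (measure_pmf (X n)) borel real) (real k + 1 / 2)) \<longlonglongrightarrow> cdf ?D (real k + 1 / 2)"
    using assms by (simp add: converges_in_distribution_def weak_conv_m_def weak_conv_def)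
  then show ?thesis by (simp only: prob_of_nat_cdf)
qed

lemma converges_in_distribution_pmf:
  assumes "converges_in_distribution X Y"
  shows "(\<lambda>n. pmf (X n) k) \<longlonglongrightarrow> pmf Y k"
proof (cases k)
  case 0
  have "{..0 :: nat} = {0}" by auto
  with converges_in_distribution_prob_atMost[OF assms, of 0] 0 show ?thesis
    by (simp add: measure_pmf_single)
next
  case (Suc j)
  have "pmf Z k = measure_pmf.prob Z {..k} - measure_pmf.prob Z {..j}" for Z
  proof -
    have "{..k} - {..j} = {k}" using Suc by auto
    then have "pmf Z k = measure_pmf.prob Z ({..k} - {..j})" by (simp add: measure_pmf_single)
    then show ?thesis using Suc by (simp add: measure_pmf.finite_measure_Diff)
  qed
  then show ?thesis
    using tendsto_diff[OF converges_in_distribution_prob_atMost[OF assms, of k]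
        converges_in_distribution_prob_atMost[OF assms, of j]] by simp
qed

lemma pmf_l_degree:
  assumes "N > 0"
  shows "pmf (l_degree_pmf N dl) k = real (card {v \<in> {1..N}. dl v = k}) / real N"
proof -
  have "{1..N} \<inter> dl -` {k} = {v \<in> {1..N}. dl v = k}" by auto
  with assms show ?thesis
    by (simp add: l_degree_pmf_def pmf_map measure_pmf_of_set)
qed

lemma expectation_l_degree:
  assumes "N > 0"
  shows "measure_pmf.expectation (l_degree_pmf N dl) real = real (\<Sum>v\<in>{1..N}. dl v) / real N"
  using assms by (simp add: l_degree_pmf_def integral_pmf_of_set)

lemma expectation_r_degree:
  assumes "M > 0"
  shows "measure_pmf.expectation (r_degree_pmf M Com) real = real (\<Sum>a\<in>{1..M}. csize (Com a)) / real M"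
  using assms by (simp add: r_degree_pmf_def integral_pmf_of_set)

text \<open>Compares a falling factorial of fixed length with a power; each further factor
  contributes h / (h - k).\<close>

lemma power_fact_ratio_tendsto:
  "((\<lambda>h::nat. real h ^ k * (fact (h - k) / fact h)) \<longlongrightarrow> 1) at_top"
proof (induction k)
  case (Suc k)
  have "((\<lambda>h::nat. real h / (real h - real k)) \<longlongrightarrow> 1) at_top" by real_asymp
  from tendsto_mult[OF Suc.IH this]
  have lim: "((\<lambda>h::nat. real h ^ k * (fact (h - k) / fact h) * (real h / (real h - real k))) \<longlongrightarrow> 1) at_top"
    by simp
  moreover have "\<forall>\<^sub>F h in at_top. real h ^ k * (fact (h - k) / fact h) * (real h / (real h - real k)) =
      real h ^ Suc k * (fact (h - Suc k) / fact h)"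
    using eventually_gt_at_top[of k]
  proof eventually_elim
    case (elim h)
    then have "h - k = Suc (h - Suc k)" by simp
    then have "(fact (h - k) :: real) = (real h - real k) * fact (h - Suc k)"
      using elim by (simp add: of_nat_diff)
    then show ?case using elim by simp
  qed
  ultimately show ?case by (rule Lim_transform_eventually)
qed simp

text \<open>Absorbs the candidates given up for injectivity in \<open>card_placements_ge\<close>: a
  bounded loss vanishes on the scale h.\<close>

lemma tendsto_truncated_subtraction:
  assumes lim: "(\<lambda>n. real (c n) / h n) \<longlonglongrightarrow> w" and h: "filterlim h at_top sequentially"
  shows "(\<lambda>n. real (c n - m) / h n) \<longlonglongrightarrow> w"
proof (rule tendsto_sandwich[OF _ _ _ lim])
  have "(\<lambda>n. real m / h n) \<longlonglongrightarrow> 0" using h by (rule tendsto_divide_0[OF tendsto_const filterlim_at_top_imp_at_infinity])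
  from tendsto_diff[OF lim this] show "(\<lambda>n. real (c n) / h n - real m / h n) \<longlonglongrightarrow> w" by simp
  have pos: "\<forall>\<^sub>F n in sequentially. h n > 0" using h by (simp add: filterlim_at_top_dense)
  then show "\<forall>\<^sub>F n in sequentially. real (c n) / h n - real m / h n \<le> real (c n - m) / h n"
    by eventually_elim (auto simp: diff_divide_distrib[symmetric] intro!: divide_right_mono)
  from pos show "\<forall>\<^sub>F n in sequentially. real (c n - m) / h n \<le> real (c n) / h n"
    by eventually_elim (auto intro!: divide_right_mono)
qed

text \<open>Chebyshev's inequality around the limit c instead of the mean. Expanding the square, E
  (X - c)^2 is at most U - 2 c L + c^2, which tends to 0; since c is nonnegative, a lower bound for
  the mean is what enters.\<close>

lemma second_moment_convergence:
  assumes P: "\<And>n. prob_space (P n)"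
    and int: "\<And>n. integrable (P n) (X n)" "\<And>n. integrable (P n) (\<lambda>\<omega>. (X n \<omega>)\<^sup>2)"
    and lower: "\<forall>\<^sub>F n in sequentially. L n \<le> integral\<^sup>L (P n) (X n)"
    and upper: "\<forall>\<^sub>F n in sequentially. integral\<^sup>L (P n) (\<lambda>\<omega>. (X n \<omega>)\<^sup>2) \<le> U n"
    and L: "L \<longlonglongrightarrow> c" and U: "U \<longlonglongrightarrow> c\<^sup>2" and c: "c \<ge> 0"
  shows "converges_in_probability P X c"
  unfolding converges_in_probability_def
proof (intro allI impI)
  fix \<epsilon> :: real assume \<epsilon>: "\<epsilon> > 0"
  show "(\<lambda>n. \<P>(\<omega> in P n. \<epsilon> < \<bar>X n \<omega> - c\<bar>)) \<longlonglongrightarrow> 0"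
  proof (rule tendsto_sandwich[OF _ _ tendsto_const])
    have "(\<lambda>n. U n - 2 * c * L n + c\<^sup>2) \<longlonglongrightarrow> c\<^sup>2 - 2 * c * c + c\<^sup>2" by (intro tendsto_intros L U)
    then have "(\<lambda>n. (U n - 2 * c * L n + c\<^sup>2) / \<epsilon>\<^sup>2) \<longlonglongrightarrow> (c\<^sup>2 - 2 * c * c + c\<^sup>2) / \<epsilon>\<^sup>2"
      using \<epsilon> by (intro tendsto_divide) auto
    then show "(\<lambda>n. (U n - 2 * c * L n + c\<^sup>2) / \<epsilon>\<^sup>2) \<longlonglongrightarrow> 0" by (simp add: power2_eq_square)
    show "\<forall>\<^sub>F n in sequentially. \<P>(\<omega> in P n. \<epsilon> < \<bar>X n \<omega> - c\<bar>) \<le> (U n - 2 * c * L n + c\<^sup>2) / \<epsilon>\<^sup>2"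
      using lower upper
    proof eventually_elim
      case (elim n)
      interpret prob_space "P n" by (rule P)
      have meas [measurable]: "X n \<in> borel_measurable (P n)" using int(1) by (rule borel_measurable_integrable)
      have sq: "(X n \<omega> - c)\<^sup>2 = (X n \<omega>)\<^sup>2 - 2 * c * X n \<omega> + c\<^sup>2" for \<omega>
        by (simp add: power2_diff)
      have int': "integrable (P n) (\<lambda>\<omega>. (X n \<omega> - c)\<^sup>2)" unfolding sq using int by auto
      have "\<P>(\<omega> in P n. \<epsilon> < \<bar>X n \<omega> - c\<bar>) \<le> expectation (\<lambda>\<omega>. (X n \<omega> - c)\<^sup>2 / \<epsilon>\<^sup>2)"
      proof -
        have "indicator {\<omega> \<in> space (P n). \<epsilon> < \<bar>X n \<omega> - c\<bar>} \<omega> \<le> (X n \<omega> - c)\<^sup>2 / \<epsilon>\<^sup>2" for \<omega>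
        proof (cases "\<epsilon> < \<bar>X n \<omega> - c\<bar>")
          case True
          then have "\<epsilon>\<^sup>2 \<le> (X n \<omega> - c)\<^sup>2" using \<epsilon> power_mono[of \<epsilon> "\<bar>X n \<omega> - c\<bar>" 2] by simp
          then show ?thesis using \<epsilon> by (auto simp: indicator_def)
        qed auto
        moreover have "{\<omega> \<in> space (P n). \<epsilon> < \<bar>X n \<omega> - c\<bar>} \<in> events" by measurable
        then have "integrable (P n) (indicat_real {\<omega> \<in> space (P n). \<epsilon> < \<bar>X n \<omega> - c\<bar>})"
          by (rule integrable_real_indicator) (simp add: less_top[symmetric])
        ultimately have "expectation (indicator {\<omega> \<in> space (P n). \<epsilon> < \<bar>X n \<omega> - c\<bar>}) \<le> expectation (\<lambda>\<omega>. (X n \<omega> - c)\<^sup>2 / \<epsilon>\<^sup>2)"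
          using int' by (intro integral_mono) auto
        then show ?thesis by simp
      qed
      also have "\<dots> = (expectation (\<lambda>\<omega>. (X n \<omega>)\<^sup>2) - 2 * c * expectation (X n) + c\<^sup>2) / \<epsilon>\<^sup>2"
        using int by (simp add: sq prob_space)
      also have "\<dots> \<le> (U n - 2 * c * L n + c\<^sup>2) / \<epsilon>\<^sup>2"
        using elim c by (intro divide_right_mono add_right_mono diff_mono mult_left_mono) auto
      finally show ?case .
    qed
  qed (simp add: measure_nonneg)
qed

section \<open>Convergence of the fraction of individuals of a given type\<close>

context
  fixes N M :: "nat \<Rightarrow> nat" and dl :: "nat \<Rightarrow> nat \<Rightarrow> nat" and Com :: "nat \<Rightarrow> nat \<Rightarrow> cgraph"
    and p :: "nat pmf" and \<mu> :: "cgraph pmf"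
  assumes balance: "\<And>n. (\<Sum>v\<in>{1..N n}. dl n v) = (\<Sum>a\<in>{1..M n}. csize (Com n a))"
    and dl_pos: "\<And>n v. v \<in> {1..N n} \<Longrightarrow> dl n v \<ge> 1"
    and N_lim: "filterlim N at_top sequentially" and M_lim: "filterlim M at_top sequentially"
    and l_degree_lim: "\<And>k. (\<lambda>n. real (card {v \<in> {1..N n}. dl n v = k}) / real (N n)) \<longlonglongrightarrow> pmf p k"
    and l_mean_lim: "(\<lambda>n. real (\<Sum>v\<in>{1..N n}. dl n v) / real (N n)) \<longlonglongrightarrow> measure_pmf.expectation p real"
    and l_mean_pos: "measure_pmf.expectation p real > 0"
    and com_lim: "\<And>H. H \<in> set_pmf \<mu> \<Longrightarrow>
        (\<lambda>n. real (card {a \<in> {1..M n}. Com n a = H}) / real (M n)) \<longlonglongrightarrow> pmf \<mu> H"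
    and r_mean_lim: "(\<lambda>n. real (\<Sum>v\<in>{1..N n}. dl n v) / real (M n))
        \<longlonglongrightarrow> measure_pmf.expectation (map_pmf csize \<mu>) real"
    and r_mean_pos: "measure_pmf.expectation (map_pmf csize \<mu>) real > 0"
begin

abbreviation (input) "h n \<equiv> \<Sum>v\<in>{1..N n}. dl n v"

lemma half_edge_total_at_top: "filterlim h at_top sequentially"
proof (rule filterlim_at_top_mono[OF N_lim])
  have "N n \<le> h n" for n
    using sum_mono[of "{1..N n}" "\<lambda>_. 1" "dl n"] dl_pos by simp
  then show "\<forall>\<^sub>F n in sequentially. N n \<le> h n" by simp
qed

context
  fixes R :: nat and t :: "nat list \<Rightarrow> label"
  assumes good: "\<And>u. u \<in> tree_ball R t \<Longrightarrow> good_label \<mu> u (t u)"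
begin

abbreviation (input) "cand n u \<equiv> card (candidates (N n) (M n) (dl n) (Com n) t u)"

lemma proper_t: "proper_tree R t"
  using good by (simp add: proper_tree_def good_label_def)

lemma root_candidates_lim: "(\<lambda>n. real (cand n []) / real (N n)) \<longlonglongrightarrow> label_weight p \<mu> [] (t [])"
  using l_degree_lim[of "nchildren (t [])"]
  by (simp add: candidates_def label_weight_def tree_degree_def)

text \<open>Both half-edge counts equal h. So h can be compared with N for individuals and with M
  for communities, and the two mean degrees appear as denominators.\<close>

lemma candidates_lim:
  assumes u: "u \<in> tree_ball R t" "u \<noteq> []"
  shows "(\<lambda>n. real (cand n u) / real (h n)) \<longlonglongrightarrow> label_weight p \<mu> u (t u)"
proof -
  have pos: "\<forall>\<^sub>F n in sequentially. N n > 0" "\<forall>\<^sub>F n in sequentially. M n > 0"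
    using eventually_compose_filterlim[OF eventually_gt_at_top[of 0] N_lim]
      eventually_compose_filterlim[OF eventually_gt_at_top[of 0] M_lim] by auto
  show ?thesis
  proof (cases "even (length u)")
    case True
    have "(\<lambda>n. real (cand n u) / real (N n) / (real (h n) / real (N n))) \<longlonglongrightarrow> label_weight p \<mu> u (t u)"
      using tendsto_divide[OF l_degree_lim[of "nchildren (t u) + 1"] l_mean_lim] l_mean_pos True u(2)
      by (simp add: candidates_def label_weight_def tree_degree_def)
    moreover have "\<forall>\<^sub>F n in sequentially. real (cand n u) / real (N n) / (real (h n) / real (N n)) = real (cand n u) / real (h n)"
      using pos(1) by eventually_elim simp
    ultimately show ?thesis by (rule Lim_transform_eventually)
  next
    case False
    obtain H where H: "community (t u) = Some H" "H \<in> set_pmf \<mu>"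
      using good[OF u(1)] False by (auto simp: good_label_def proper_label_def)
    have "candidates (N n) (M n) (dl n) (Com n) t u = {a \<in> {1..M n}. Com n a = H}" for n
      using False H by (auto simp: candidates_def)
    then have "(\<lambda>n. real (cand n u) / real (M n) / (real (h n) / real (M n))) \<longlonglongrightarrow> label_weight p \<mu> u (t u)"
      using tendsto_divide[OF com_lim[OF H(2)] r_mean_lim] r_mean_pos False H u(2)
      by (simp add: label_weight_def)
    moreover have "\<forall>\<^sub>F n in sequentially. real (cand n u) / real (M n) / (real (h n) / real (M n)) = real (cand n u) / real (h n)"
      using pos(2) by eventually_elim simp
    ultimately show ?thesis by (rule Lim_transform_eventually)
  qed
qed

lemma occurrences_converge:
  "converges_in_probability (\<lambda>n. measure_pmf (matching_pmf (N n) (M n) (dl n) (Com n)))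
     (\<lambda>n \<omega>. real (card (occurrences (N n) (M n) (dl n) (Com n) R t \<omega>)) / real (N n))
     (\<Prod>u\<in>tree_ball R t. label_weight p \<mu> u (t u))"
proof -
  let ?T = "tree_ball R t" let ?T' = "tree_ball R t - {[]}"
  let ?e = "card ?T'" let ?m = "card ?T"
  let ?w = "\<lambda>u. label_weight p \<mu> u (t u)"
  let ?f = "\<lambda>k n. (fact (h n - k) / fact (h n) :: real)"
  let ?X = "\<lambda>n \<omega>. real (card (occurrences (N n) (M n) (dl n) (Com n) R t \<omega>))"
  let ?P = "\<lambda>n. card (placements (N n) (M n) (dl n) (Com n) R t)"
  have split: "(\<Prod>u\<in>?T. g u) = g [] * (\<Prod>u\<in>?T'. g u)" for g :: "nat list \<Rightarrow> real"
    by (rule prod.remove) (auto simp: finite_tree_ball)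
  have h_real: "filterlim (\<lambda>n. real (h n)) at_top sequentially"
    using half_edge_total_at_top filterlim_compose[OF filterlim_real_sequentially] by blast
  have N_real: "filterlim (\<lambda>n. real (N n)) at_top sequentially"
    using N_lim filterlim_compose[OF filterlim_real_sequentially] by blast
  have ratio: "(\<lambda>n. real (h n) ^ k * ?f k n) \<longlonglongrightarrow> 1" for k
    by (rule filterlim_compose[OF power_fact_ratio_tendsto half_edge_total_at_top])
  \<comment> \<open>\<open>L\<close> and \<open>U\<close> are the moment bounds regrouped into
    convergent factors: the root over N, every other vertex over h, and the compensating power of h
    with the factorials. The last term of \<open>U\<close> comes from the overlapping pairs.\<close>
  define L where "L n = real (cand n [] - ?m) / real (N n) * (\<Prod>u\<in>?T'. real (cand n u - ?m) / real (h n))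
      * (real (h n) ^ ?e * ?f ?e n)" for n
  define U where "U n = (real (cand n []) / real (N n) * (\<Prod>u\<in>?T'. real (cand n u) / real (h n)))\<^sup>2
      * (real (h n) ^ (2 * ?e) * ?f (2 * ?e) n) + (real ?m)\<^sup>2 / real (N n)" for n
  have Lw: "L \<longlonglongrightarrow> ?w [] * (\<Prod>u\<in>?T'. ?w u) * 1"
    unfolding L_def
    by (intro tendsto_mult tendsto_prod ratio tendsto_truncated_subtraction[OF _ h_real]
        tendsto_truncated_subtraction[OF _ N_real] root_candidates_lim candidates_lim) auto
  have "(\<lambda>n. (real ?m)\<^sup>2 / real (N n)) \<longlonglongrightarrow> 0"
    by (rule tendsto_divide_0[OF tendsto_const filterlim_at_top_imp_at_infinity[OF N_real]])
  then have Uw: "U \<longlonglongrightarrow> (?w [] * (\<Prod>u\<in>?T'. ?w u))\<^sup>2 * 1 + 0"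
    unfolding U_def
    by (intro tendsto_add tendsto_mult tendsto_power tendsto_prod ratio root_candidates_lim candidates_lim) auto
  have pos: "\<forall>\<^sub>F n in sequentially. N n > 0 \<and> h n > 0"
    using eventually_compose_filterlim[OF eventually_gt_at_top[of 0] N_lim]
      eventually_compose_filterlim[OF eventually_gt_at_top[of 0] half_edge_total_at_top]
    by eventually_elim simp
  show ?thesis
  proof (rule second_moment_convergence[where L = L and U = U])
    show "prob_space (measure_pmf (matching_pmf (N n) (M n) (dl n) (Com n)))" for n
      by (rule prob_space_measure_pmf)
    show "integrable (measure_pmf (matching_pmf (N n) (M n) (dl n) (Com n))) (\<lambda>\<omega>. ?X n \<omega> / real (N n))"
      "integrable (measure_pmf (matching_pmf (N n) (M n) (dl n) (Com n))) (\<lambda>\<omega>. (?X n \<omega> / real (N n))\<^sup>2)" for n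
      by (rule integrable_matching_pmf[OF balance])+
    show "\<forall>\<^sub>F n in sequentially. L n \<le>
        measure_pmf.expectation (matching_pmf (N n) (M n) (dl n) (Com n)) (\<lambda>\<omega>. ?X n \<omega> / real (N n))"
      using pos
    proof eventually_elim
      case (elim n)
      have "L n = real (\<Prod>u\<in>?T. cand n u - ?m) * ?f ?e n / real (N n)"
      proof -
        have "a / b * (c / y ^ k) * (y ^ k * f) = a * c * f / b" if "y \<noteq> 0" for a b c f y :: real and k
          using that by simp
        note alg = this
        have "real (h n) \<noteq> 0" using elim by linarith
        then show ?thesis unfolding L_def of_nat_prod split prod_dividef prod_constant by (rule alg)
      qed
      also have "\<dots> \<le> real (?P n) * ?f ?e n / real (N n)"
        using card_placements_ge[OF balance proper_t, of n]
        by (intro divide_right_mono mult_right_mono) (simp_all only: of_nat_le_iff, simp_all)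
      finally show ?case using expectation_occurrences[OF balance proper_t, of n] by simp
    qed
    show "\<forall>\<^sub>F n in sequentially.
        measure_pmf.expectation (matching_pmf (N n) (M n) (dl n) (Com n)) (\<lambda>\<omega>. (?X n \<omega> / real (N n))\<^sup>2) \<le> U n"
      using pos
    proof eventually_elim
      case (elim n)
      have "real (?P n) \<le> (\<Prod>u\<in>?T. real (cand n u))"
        using card_placements_le[OF balance proper_t, of n]
        by (simp only: of_nat_le_iff flip: of_nat_prod)
      then have "(real (?P n))\<^sup>2 * ?f (2 * ?e) n + (real ?m)\<^sup>2 * real (N n) \<le>
          (\<Prod>u\<in>?T. real (cand n u))\<^sup>2 * ?f (2 * ?e) n + (real ?m)\<^sup>2 * real (N n)"
        by (intro add_right_mono mult_right_mono power_mono) auto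
      then have "measure_pmf.expectation (matching_pmf (N n) (M n) (dl n) (Com n)) (\<lambda>\<omega>. (?X n \<omega>)\<^sup>2) \<le>
          (\<Prod>u\<in>?T. real (cand n u))\<^sup>2 * ?f (2 * ?e) n + (real ?m)\<^sup>2 * real (N n)"
        using second_moment_occurrences[OF balance proper_t, of n] by linarith
      then have "measure_pmf.expectation (matching_pmf (N n) (M n) (dl n) (Com n)) (\<lambda>\<omega>. (?X n \<omega>)\<^sup>2) / (real (N n))\<^sup>2 \<le>
          ((\<Prod>u\<in>?T. real (cand n u))\<^sup>2 * ?f (2 * ?e) n + (real ?m)\<^sup>2 * real (N n)) / (real (N n))\<^sup>2"
        by (rule divide_right_mono) simp
      also have "\<dots> = U n"
      proof -
        have "((a * c)\<^sup>2 * f + m * b) / b\<^sup>2 = (a / b * (c / y ^ k))\<^sup>2 * (y ^ (2 * k) * f) + m / b"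
          if "y \<noteq> 0" "b \<noteq> 0" for a b c f m y :: real and k
          using that by (simp add: field_simps power2_eq_square flip: power_add) (simp add: mult_2_right)
        note alg = this
        have "real (h n) \<noteq> 0" "real (N n) \<noteq> 0" using elim by linarith+
        then show ?thesis unfolding U_def split prod_dividef prod_constant by (rule alg)
      qed
      finally show ?case by (simp add: power_divide)
    qed
    show "L \<longlonglongrightarrow> (\<Prod>u\<in>?T. ?w u)" using Lw by (simp add: split)
    show "U \<longlonglongrightarrow> (\<Prod>u\<in>?T. ?w u)\<^sup>2" using Uw by (simp add: split)
    show "(\<Prod>u\<in>?T. ?w u) \<ge> 0"
      using l_mean_pos r_mean_pos by (intro prod_nonneg) (auto simp: label_weight_def)
  qed
qed

end

end


section \<open>Local convergence\<close>

context
  fixes N M r :: nat and dl :: "nat \<Rightarrow> nat" and Com :: "nat \<Rightarrow> cgraph" and \<mu> :: "cgraph pmf"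
    and S :: "(nat list \<Rightarrow> label) set" and \<omega> :: "nat \<times> nat \<Rightarrow> nat \<times> nat"
    and R :: "'g rooted"
  assumes balance: "(\<Sum>v\<in>{1..N}. dl v) = (\<Sum>a\<in>{1..M}. csize (Com a))"
    and Com: "\<And>a. a \<in> {1..M} \<Longrightarrow> community_graph (Com a)"
    and S: "finite S" "S \<subseteq> good_trees \<mu> (2 * r + 1)"
    and \<omega>: "\<omega> \<in> matchings N M dl Com"
begin

abbreviation (input) "occ t \<equiv> occurrences N M dl Com (2 * r + 1) t \<omega>"

text \<open>Distinct trees occur at distinct vertices, so their occurrences can be added up.\<close>

lemma sum_occurrences_le:
  assumes S': "S' \<subseteq> S" and W: "\<And>t. t \<in> S' \<Longrightarrow> nbhd r (CP t) [] \<simeq>\<^sub>r R \<longleftrightarrow> b"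
  shows "(\<Sum>t\<in>S'. card (occ t)) \<le> card {v \<in> {1..N}. nbhd r (rigc N M dl Com \<omega>) v \<simeq>\<^sub>r R \<longleftrightarrow> b}"
proof -
  let ?V = "\<lambda>t. (\<lambda>\<psi>. \<psi> []) ` occ t"
  have proper: "proper_tree (2 * r + 1) t" if "t \<in> S'" for t
  proof -
    have "t \<in> good_trees \<mu> (2 * r + 1)" using that S' S by blast
    then show ?thesis using good_treesD(2)[of t \<mu>] by (simp add: proper_tree_def good_label_def)
  qed
  have occD: "\<psi> \<in> placements N M dl Com (2 * r + 1) t" "realises (2 * r + 1) t \<omega> \<psi>"
    if "t \<in> S'" "\<psi> \<in> occ t" for \<psi> t
    using that by (simp_all only: occurrences_def mem_Collect_eq)
  have card: "card (?V t) = card (occ t)" if "t \<in> S'" for t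
    by (rule card_image) (rule inj_occurrence_root[OF balance proper[OF that] \<omega>])
  have disj: "?V t \<inter> ?V t' = {}" if t: "t \<in> S'" "t' \<in> S'" "t \<noteq> t'" for t t'
  proof (rule ccontr)
    assume "?V t \<inter> ?V t' \<noteq> {}"
    then obtain \<psi> \<psi>' where \<psi>: "\<psi> \<in> occ t" "\<psi>' \<in> occ t'" "\<psi> [] = \<psi>' []" by auto
    have "\<forall>u\<in>tree_ball (2 * r + 1) t. t' u = t u"
      using tree_determined_by_root[OF \<omega> proper[OF t(1)] occD[OF t(1) \<psi>(1)] proper[OF t(2)] occD[OF t(2) \<psi>(2)] \<psi>(3)]
      by blast
    then have "truncated (2 * r + 1) t' = truncated (2 * r + 1) t" by (simp only: truncated_eq_iff)
    moreover have "t \<in> good_trees \<mu> (2 * r + 1)" "t' \<in> good_trees \<mu> (2 * r + 1)" using t S' S by auto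
    ultimately show False using t(3) good_treesD(1) by metis
  qed
  have sub: "?V t \<subseteq> {v \<in> {1..N}. nbhd r (rigc N M dl Com \<omega>) v \<simeq>\<^sub>r R \<longleftrightarrow> b}" if t: "t \<in> S'" for t
  proof clarify
    fix \<psi> assume \<psi>: "\<psi> \<in> occ t"
    have iso: "nbhd r (CP t) [] \<simeq>\<^sub>r nbhd r (rigc N M dl Com \<omega>) (\<psi> [])"
      using nbhd_rigc_placement[OF proper[OF t] \<omega> occD[OF t \<psi>] Com] .
    have "nbhd r (CP t) [] \<simeq>\<^sub>r R \<longleftrightarrow> nbhd r (rigc N M dl Com \<omega>) (\<psi> []) \<simeq>\<^sub>r R"
      by (rule rooted_iso_cong[OF iso]) (simp add: root_in_nbhd CP_def)
    then show "\<psi> [] \<in> {1..N} \<and> (nbhd r (rigc N M dl Com \<omega>) (\<psi> []) \<simeq>\<^sub>r R \<longleftrightarrow> b)"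
      using W[OF t] placement_even(1)[OF occD(1)[OF t \<psi>], of "[]"] by simp
  qed
  have fin: "finite S'" using S S' finite_subset by blast
  have "(\<Sum>t\<in>S'. card (occ t)) = (\<Sum>t\<in>S'. card (?V t))"
    by (rule sum.cong) (simp_all only: card)
  also have "\<dots> = card (\<Union>t\<in>S'. ?V t)"
    using fin disj finite_imageI[OF finite_occurrences[OF balance proper]]
    by (intro card_UN_disjoint[symmetric]) blast+
  also have "\<dots> \<le> card {v \<in> {1..N}. nbhd r (rigc N M dl Com \<omega>) v \<simeq>\<^sub>r R \<longleftrightarrow> b}"
    using sub by (intro card_mono) auto
  finally show ?thesis .
qed

text \<open>The fraction lies between the share of the matching types in S and 1 minus the share of
  the others, because individuals of no type in S can go either way. The number c lies between the
  same expressions formed with the weights w. The gap is the mass missed by S, up to the deviations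
  of the single types.\<close>

lemma fraction_deviation_le:
  assumes N: "N > 0"
    and c: "(\<Sum>t\<in>{t \<in> S. nbhd r (CP t) [] \<simeq>\<^sub>r R}. w t) \<le> c"
      "c \<le> 1 - (\<Sum>t\<in>{t \<in> S. \<not> nbhd r (CP t) [] \<simeq>\<^sub>r R}. w t)"
  shows "\<bar>(\<Sum>v\<in>{1..N}. of_bool (nbhd r (rigc N M dl Com \<omega>) v \<simeq>\<^sub>r R)) / real N - c\<bar> \<le>
    1 - (\<Sum>t\<in>S. w t) + (\<Sum>t\<in>S. \<bar>real (card (occ t)) / real N - w t\<bar>)"
proof -
  let ?q = "\<lambda>v. nbhd r (rigc N M dl Com \<omega>) v \<simeq>\<^sub>r R"
  let ?x = "\<lambda>t. real (card (occ t)) / real N"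
  let ?Y = "{t \<in> S. nbhd r (CP t) [] \<simeq>\<^sub>r R}" and ?Z = "{t \<in> S. \<not> nbhd r (CP t) [] \<simeq>\<^sub>r R}"
  let ?F = "real (card {v \<in> {1..N}. ?q v}) / real N"
  have F: "(\<Sum>v\<in>{1..N}. of_bool (?q v)) / real N = ?F" by (simp add: Int_def)
  have "(\<Sum>t\<in>?Y. card (occ t)) \<le> card {v \<in> {1..N}. ?q v}"
    by (rule order_trans[OF sum_occurrences_le[of ?Y True]]) simp_all
  then have Y: "(\<Sum>t\<in>?Y. ?x t) \<le> ?F"
    using N by (simp add: divide_right_mono flip: sum_divide_distrib of_nat_sum)
  have "(\<Sum>t\<in>?Z. card (occ t)) \<le> card {v \<in> {1..N}. \<not> ?q v}"
    by (rule order_trans[OF sum_occurrences_le[of ?Z False]]) simp_all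
  moreover have "card {v \<in> {1..N}. \<not> ?q v} + card {v \<in> {1..N}. ?q v} = N"
  proof -
    have "{v \<in> {1..N}. \<not> ?q v} \<union> {v \<in> {1..N}. ?q v} = {1..N}" by auto
    then show ?thesis by (subst card_Un_disjoint[symmetric]) auto
  qed
  ultimately have "(\<Sum>t\<in>?Z. card (occ t)) + card {v \<in> {1..N}. ?q v} \<le> N" by linarith
  then have "real (\<Sum>t\<in>?Z. card (occ t)) / real N + ?F \<le> 1"
    using N by (simp add: field_simps flip: of_nat_add of_nat_sum)
  then have Z: "(\<Sum>t\<in>?Z. ?x t) + ?F \<le> 1" by (simp add: sum_divide_distrib)
  have split: "(\<Sum>t\<in>S. g t) = (\<Sum>t\<in>?Y. g t) + (\<Sum>t\<in>?Z. g t)" for g :: "(nat list \<Rightarrow> label) \<Rightarrow> real"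
    using S(1) by (subst sum.union_disjoint[symmetric]) (auto intro: sum.cong)
  have dev: "\<bar>(\<Sum>t\<in>A. ?x t) - (\<Sum>t\<in>A. w t)\<bar> \<le> (\<Sum>t\<in>A. \<bar>?x t - w t\<bar>)" for A
    by (simp only: sum_subtractf[symmetric] sum_abs)
  have "0 \<le> (\<Sum>t\<in>?Y. \<bar>?x t - w t\<bar>)" "0 \<le> (\<Sum>t\<in>?Z. \<bar>?x t - w t\<bar>)" by (simp_all add: sum_nonneg)
  then show ?thesis
    unfolding F split using Y Z c dev[of ?Y] dev[of ?Z] by linarith
qed

end

theorem theorem2p8:
  fixes \<H> :: "cgraph set"
    and N M :: "nat \<Rightarrow> nat"
    and dl :: "nat \<Rightarrow> nat \<Rightarrow> nat"
    and Com :: "nat \<Rightarrow> nat \<Rightarrow> cgraph"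
    and p :: "nat pmf"
    and \<mu> :: "cgraph pmf"
    and G :: "'g mgraph" and root :: 'g and r :: nat
  assumes reps: "community_reps \<H>"
    and params: "\<And>n. rigc_params \<H> (N n) (M n) (dl n) (Com n)"
    and N_lim: "filterlim N at_top sequentially"
    and M_lim: "filterlim M at_top sequentially"
    and p_pos: "set_pmf p \<subseteq> {1..}"
    and A: "converges_in_distribution (\<lambda>n. l_degree_pmf (N n) (dl n)) p"
    and B_fin: "integrable (measure_pmf p) real"
    and B: "(\<lambda>n. measure_pmf.expectation (l_degree_pmf (N n) (dl n)) real)
              \<longlonglongrightarrow> measure_pmf.expectation p real"
    and C_supp: "set_pmf \<mu> \<subseteq> \<H>"
    and C: "\<And>H. H \<in> \<H> \<Longrightarrow>
              (\<lambda>n. real (card {a \<in> {1..M n}. Com n a = H}) / real (M n)) \<longlonglongrightarrow> pmf \<mu> H"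
    and D_fin: "integrable (measure_pmf (map_pmf csize \<mu>)) real"
    and D: "(\<lambda>n. measure_pmf.expectation (r_degree_pmf (M n) (Com n)) real)
              \<longlonglongrightarrow> measure_pmf.expectation (map_pmf csize \<mu>) real"
    and rooted: "rooted_graph (G, root)"
  shows "converges_in_probability
           (\<lambda>n. measure_pmf (matching_pmf (N n) (M n) (dl n) (Com n)))
           (\<lambda>n \<omega>. (\<Sum>v\<in>{1..N n}.
                      of_bool (nbhd r (rigc (N n) (M n) (dl n) (Com n) \<omega>) v \<simeq>\<^sub>r nbhd r G root))
                    / real (N n))
           \<P>(\<tau> in bp_space p \<mu>. nbhd r (CP \<tau>) [] \<simeq>\<^sub>r nbhd r G root)"
proof -
  let ?h = "\<lambda>n. \<Sum>v\<in>{1..N n}. dl n v"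
  let ?B = "bp_space p \<mu>"
  have params': "\<And>n v. v \<in> {1..N n} \<Longrightarrow> dl n v \<ge> 1" "\<And>n a. a \<in> {1..M n} \<Longrightarrow> Com n a \<in> \<H>"
    "\<And>n. ?h n = (\<Sum>a\<in>{1..M n}. csize (Com n a))"
    using params unfolding rigc_params_def by blast+
  have comm: "\<And>H. H \<in> \<H> \<Longrightarrow> community_graph H" using reps by (simp add: community_reps_def)
  have N_pos: "\<forall>\<^sub>F n in sequentially. N n > 0" and M_pos: "\<forall>\<^sub>F n in sequentially. M n > 0"
    using eventually_compose_filterlim[OF eventually_gt_at_top[of 0] N_lim]
      eventually_compose_filterlim[OF eventually_gt_at_top[of 0] M_lim] by auto
  have pos: "measure_pmf.expectation X real > 0"
    if int: "integrable (measure_pmf X) real" and X: "set_pmf X \<subseteq> {1..}" for X :: "nat pmf"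
  proof -
    have "measure_pmf.expectation X (\<lambda>_. 1) \<le> measure_pmf.expectation X real"
      using X by (intro integral_mono_AE int) (auto intro!: AE_pmfI)
    then show ?thesis by simp
  qed
  have p_mean: "measure_pmf.expectation p real > 0" by (rule pos[OF B_fin p_pos])
  have "set_pmf (map_pmf csize \<mu>) \<subseteq> {1..}"
    using C_supp comm by (fastforce simp: community_graph_def)
  then have \<mu>_mean: "measure_pmf.expectation (map_pmf csize \<mu>) real > 0" by (rule pos[OF D_fin])
  have \<mu>_comm: "\<And>H. H \<in> set_pmf \<mu> \<Longrightarrow> community_graph H" using C_supp comm by blast
  have l_deg: "(\<lambda>n. real (card {v \<in> {1..N n}. dl n v = k}) / real (N n)) \<longlonglongrightarrow> pmf p k" for k
    using converges_in_distribution_pmf[OF A, of k]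
    by (rule Lim_transform_eventually) (use N_pos in \<open>eventually_elim, simp only: pmf_l_degree\<close>)
  have l_mean: "(\<lambda>n. real (?h n) / real (N n)) \<longlonglongrightarrow> measure_pmf.expectation p real"
    using B by (rule Lim_transform_eventually) (use N_pos in \<open>eventually_elim, simp only: expectation_l_degree\<close>)
  have r_mean: "(\<lambda>n. real (?h n) / real (M n)) \<longlonglongrightarrow> measure_pmf.expectation (map_pmf csize \<mu>) real"
    using D by (rule Lim_transform_eventually)
      (use M_pos in \<open>eventually_elim, simp only: expectation_r_degree params'(3)\<close>)
  have com_lim: "\<And>H. H \<in> set_pmf \<mu> \<Longrightarrow>
      (\<lambda>n. real (card {a \<in> {1..M n}. Com n a = H}) / real (M n)) \<longlonglongrightarrow> pmf \<mu> H"
    using C C_supp by blast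
  let ?R = "2 * r + 1"
  let ?Q = "nbhd r G root"
  let ?w = "\<lambda>t. \<Prod>u\<in>tree_ball ?R t. pmf (label_pmf p \<mu> u) (t u)"
  let ?X = "\<lambda>t n \<omega>. real (card (occurrences (N n) (M n) (dl n) (Com n) ?R t \<omega>)) / real (N n)"
  let ?\<Omega> = "\<lambda>n. measure_pmf (matching_pmf (N n) (M n) (dl n) (Com n))"
  let ?F = "\<lambda>n \<omega>. (\<Sum>v\<in>{1..N n}. of_bool (nbhd r (rigc (N n) (M n) (dl n) (Com n) \<omega>) v \<simeq>\<^sub>r ?Q)) / real (N n)"
  let ?E = "{\<tau>. nbhd r (CP \<tau>) [] \<simeq>\<^sub>r ?Q}"
  define c where "c = measure ?B ?E"
  have conv: "converges_in_probability ?\<Omega> (?X t) (?w t)" if t: "t \<in> good_trees \<mu> ?R" for t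
  proof -
    have good: "good_label \<mu> u (t u)" if "u \<in> tree_ball ?R t" for u using good_treesD(2)[OF t that] .
    have "?w t = (\<Prod>u\<in>tree_ball ?R t. label_weight p \<mu> u (t u))"
      by (intro prod.cong refl pmf_label_pmf[OF B_fin p_mean D_fin \<mu>_mean \<mu>_comm] good)
    with occurrences_converge[OF params'(3,1) N_lim M_lim l_deg l_mean p_mean com_lim r_mean \<mu>_mean good]
    show ?thesis by simp
  qed
  have "converges_in_probability ?\<Omega> ?F c"
    unfolding converges_in_probability_def
  proof (intro allI impI)
    fix \<epsilon> :: real assume \<epsilon>: "\<epsilon> > 0"
    obtain S where S: "finite S" "S \<subseteq> good_trees \<mu> ?R"
      and mass: "measure ?B (\<Union>t\<in>S. {\<tau>. truncated ?R \<tau> = t}) > 1 - \<epsilon> / 2"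
      using good_trees_exhaust[OF set_label_pmf[OF B_fin p_mean D_fin \<mu>_mean \<mu>_comm], where \<epsilon> = "\<epsilon> / 2" and R = ?R] \<epsilon>
      by auto
    interpret P: prob_space ?B by (rule prob_space_bp)
    let ?Y = "{t \<in> S. nbhd r (CP t) [] \<simeq>\<^sub>r ?Q}" and ?Z = "{t \<in> S. \<not> nbhd r (CP t) [] \<simeq>\<^sub>r ?Q}"
    have meas: "?E \<in> sets ?B" by (rule measurable_nbhd_CP)
    have tree_event: "(\<Union>t\<in>A. {\<tau>. truncated ?R \<tau> = t}) \<in> sets ?B"
      "measure ?B (\<Union>t\<in>A. {\<tau>. truncated ?R \<tau> = t}) = (\<Sum>t\<in>A. ?w t)" if "A \<subseteq> S" for A
    proof -
      have A: "finite A" "A \<subseteq> good_trees \<mu> ?R" using that S finite_subset by blast+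
      show "(\<Union>t\<in>A. {\<tau>. truncated ?R \<tau> = t}) \<in> sets ?B"
        "measure ?B (\<Union>t\<in>A. {\<tau>. truncated ?R \<tau> = t}) = (\<Sum>t\<in>A. ?w t)"
        by (rule prob_tree_event[OF A])+
    qed
    have w_mass: "1 - (\<Sum>t\<in>S. ?w t) < \<epsilon> / 2" using mass tree_event(2)[of S] by simp
    \<comment> \<open>By locality each fibre of \<open>truncated\<close> lies entirely inside or
      entirely outside \<open>?E\<close>, so the types in \<open>?Y\<close> bound c from below and
      those in \<open>?Z\<close> bound it from above.\<close>
    have lower: "(\<Sum>t\<in>?Y. ?w t) \<le> c"
    proof -
      have "(\<Union>t\<in>?Y. {\<tau>. truncated ?R \<tau> = t}) \<subseteq> ?E"
        using nbhd_CP_truncated[of r _ ?Q] by blast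
      from P.finite_measure_mono[OF this meas] show ?thesis using tree_event(2)[of ?Y] by (simp add: c_def)
    qed
    have upper: "c \<le> 1 - (\<Sum>t\<in>?Z. ?w t)"
    proof -
      have "?E \<subseteq> space ?B - (\<Union>t\<in>?Z. {\<tau>. truncated ?R \<tau> = t})"
        unfolding space_bp using nbhd_CP_truncated[of r _ ?Q] by blast
      then have "measure ?B ?E \<le> measure ?B (space ?B - (\<Union>t\<in>?Z. {\<tau>. truncated ?R \<tau> = t}))"
        by (rule P.finite_measure_mono) (intro sets.compl_sets tree_event(1), blast)
      also have "\<dots> = 1 - (\<Sum>t\<in>?Z. ?w t)"
        unfolding P.prob_compl[OF tree_event(1)[of ?Z, OF Collect_restrict]] tree_event(2)[of ?Z, OF Collect_restrict] ..
      finally show ?thesis by (simp add: c_def)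
    qed
    \<comment> \<open>One half of \<epsilon> pays for the mass missed by S, the other is shared by
      the deviations of the types in S. The summand 2 keeps the denominator positive for empty
      S.\<close>
    define \<delta> where "\<delta> = \<epsilon> / (2 * real (card S) + 2)"
    have \<delta>: "\<delta> > 0" "real (card S) * \<delta> \<le> \<epsilon> / 2" using \<epsilon> by (simp_all add: \<delta>_def field_simps)
    have event: "\<exists>t\<in>S. \<delta> < \<bar>?X t n \<omega> - ?w t\<bar>"
      if n: "N n > 0" and \<omega>: "\<omega> \<in> matchings (N n) (M n) (dl n) (Com n)" and dev: "\<epsilon> < \<bar>?F n \<omega> - c\<bar>" for n \<omega>
    proof (rule ccontr)
      assume "\<not> ?thesis"
      then have "(\<Sum>t\<in>S. \<bar>?X t n \<omega> - ?w t\<bar>) \<le> real (card S) * \<delta>"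
        by (intro sum_bounded_above) (auto simp: not_less)
      moreover have "\<bar>?F n \<omega> - c\<bar> \<le> 1 - (\<Sum>t\<in>S. ?w t) + (\<Sum>t\<in>S. \<bar>?X t n \<omega> - ?w t\<bar>)"
        by (rule fraction_deviation_le[OF params'(3) _ S \<omega> n lower upper]) (rule comm[OF params'(2)])
      ultimately show False using dev w_mass \<delta>(2) by linarith
    qed
    show "(\<lambda>n. \<P>(\<omega> in ?\<Omega> n. \<epsilon> < \<bar>?F n \<omega> - c\<bar>)) \<longlonglongrightarrow> 0"
    proof (rule tendsto_sandwich[OF _ _ tendsto_const])
      have "(\<lambda>n. \<Sum>t\<in>S. \<P>(\<omega> in ?\<Omega> n. \<delta> < \<bar>?X t n \<omega> - ?w t\<bar>)) \<longlonglongrightarrow> (\<Sum>t\<in>S. 0)"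
        using conv S(2) \<delta>(1) by (intro tendsto_sum) (auto simp: converges_in_probability_def)
      then show "(\<lambda>n. \<Sum>t\<in>S. \<P>(\<omega> in ?\<Omega> n. \<delta> < \<bar>?X t n \<omega> - ?w t\<bar>)) \<longlonglongrightarrow> 0" by simp
      show "\<forall>\<^sub>F n in sequentially. \<P>(\<omega> in ?\<Omega> n. \<epsilon> < \<bar>?F n \<omega> - c\<bar>) \<le>
          (\<Sum>t\<in>S. \<P>(\<omega> in ?\<Omega> n. \<delta> < \<bar>?X t n \<omega> - ?w t\<bar>))"
        using N_pos
      proof eventually_elim
        case (elim n)
        have "\<P>(\<omega> in ?\<Omega> n. \<epsilon> < \<bar>?F n \<omega> - c\<bar>) \<le>
            measure (?\<Omega> n) (\<Union>t\<in>S. {\<omega>. \<delta> < \<bar>?X t n \<omega> - ?w t\<bar>})"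
          using event[OF elim]
          by (intro measure_pmf.finite_measure_mono_AE)
            (auto intro!: AE_pmfI simp: set_matching_pmf[OF params'(3)])
        also have "\<dots> \<le> (\<Sum>t\<in>S. measure (?\<Omega> n) {\<omega>. \<delta> < \<bar>?X t n \<omega> - ?w t\<bar>})"
          by (rule measure_pmf.finite_measure_subadditive_finite) (auto simp: S)
        finally show ?case by simp
      qed
    qed (simp add: measure_nonneg)
  qed
  then show ?thesis by (simp add: c_def)
qed

end
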